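(* Let $G$ be an amenable Hausdorff topological group, let $E$ be a Banach space, and let $1 \leq p < \infty$. There exists a continuous isometric linear representation $\pi$ of $G$ on a Banach space $X$, with $X$ finitely representable in $L^{p}(E)$, such that the following holds: if $d$ is a continuous left-invariant pseudo-metric on $G$ and $\sigma \colon (G,d) \to E$ is a uniformly continuous and bornologous map with exact compression modulus $\tilde{\kappa} = \tilde{\kappa}_{\sigma}$ and expansion modulus $\theta = \theta_{\sigma}$, then $\pi$ admits a cocycle $b \colon G \to X$ such that $$\forall x,y \in G \colon \quad \tilde{\kappa}(d(x,y)) \leq \Vert b(x) - b(y) \Vert_{X} \leq \theta(d(x,y)) .$$
   Context: Amenable topological group: for $g \in G$ let $\lambda_{g}(x) = gx$. $\mathrm{RUC}_{b}(G)$ is the space of bounded real-valued functions on $G$ that are uniformly continuous with respect to the right uniformity (whose entourages are the sets containing $\{(x,y) \mid xy^{-1} \in U\}$ for some neighborhood $U$ of the neutral element). $G$ is amenable if there is a positive linear map $\mu \colon \mathrm{RUC}_{b}(G) \to \mathbb{R}$ with $\mu(\mathbf{1}) = 1$ and $\mu(f \circ \lambda_{g}) = \mu(f)$ for all $f \in \mathrm{RUC}_{b}(G)$, $g \in G$. A pseudo-metric $d$ on $G$ is left-invariant if $d(gx,gy) = d(x,y)$ for all $g,x,y \in G$, and continuous if all its open balls are open in $G$. Moduli: for pseudo-metric spaces $X,Y$ and a map $\sigma \colon X \to Y$, the expansion modulus is $\theta_{\sigma} \colon [0,\infty] \to [0,\infty]$, $\theta_{\sigma}(t) = \sup\{ d_{Y}(\sigma(x),\sigma(y))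 \mid x,y \in X,\ d_{X}(x,y) \leq t\}$, and the exact compression modulus is $\tilde{\kappa}_{\sigma} \colon [0,\infty] \to [0,\infty]$, $\tilde{\kappa}_{\sigma}(t) = \inf\{ d_{Y}(\sigma(x),\sigma(y)) \mid x,y \in X,\ d_{X}(x,y) = t\}$. The map $\sigma$ is bornologous if $\theta_{\sigma}(t) < \infty$ for all $t < \infty$. A Banach space $X$ is finitely representable in a Banach space $Y$ if for every finite-dimensional linear subspace $F \subseteq X$ and every $\varepsilon > 0$ there is a linear embedding $T \colon F \to Y$ with $\Vert T \Vert, \Vert T^{-1} \Vert < 1 + \varepsilon$ (where $T^{-1}$ is defined on $T(F)$). $L^{p}(E)$ is the Banach space of equivalence classes of Bochner measurable functions $f \colon [0,1] \to E$ with $\Vert f \Vert_{L^{p}(E)} = \big(\int_{0}^{1} \Vert f(t) \Vert_{E}^{p}\, dt\big)^{1/p} < \infty$. A continuous isometric linear representation of $G$ on a Banach space $X$ is a continuous homomorphism $\pi$ from $G$ into the group $\mathrm{Iso}(X)$ of all linear isometries of $X$ (onto $X$) endowed with the strong operator topology. A cocycle for $\pi$ is a map $b \colon G \to X$ with $b(xy) = \pi(x)b(y) + b(x)$ for all $x,y \in G$. *)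

theory Defs
  imports "HOL-Analysis.Analysis" "HOL-Algebra.Algebraic_Closure_Type"
begin

section \<open>Amenable topological groups\<close>

text \<open>
  Topological groups are types of class \<open>topological_group_add\<close>. This class is not commutative:
  the product \<open>xy\<close> is written \<open>x + y\<close>, the inverse is \<open>- x\<close>, the neutral element is \<open>0\<close>, and
  \<open>x - y = x + (- y)\<close> is the product of \<open>x\<close> with the inverse of \<open>y\<close>.
\<close>

definition right_uniformly_continuous :: "('g::topological_group_add \<Rightarrow> real) \<Rightarrow> bool" where
  "right_uniformly_continuous f \<longleftrightarrow>
     (\<forall>\<epsilon>>0. \<exists>U. open U \<and> 0 \<in> U \<and> (\<forall>x y. x - y \<in> U \<longrightarrow> \<bar>f x - f y\<bar> < \<epsilon>))"

definition RUC_b :: "('g::topological_group_add \<Rightarrow> real) set" where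
  "RUC_b = {f. bounded (range f) \<and> right_uniformly_continuous f}"

definition amenable :: "'g::topological_group_add itself \<Rightarrow> bool" where
  "amenable _ \<longleftrightarrow> (\<exists>\<mu> :: ('g \<Rightarrow> real) \<Rightarrow> real.
     (\<forall>f\<in>RUC_b. \<forall>h\<in>RUC_b. \<mu> (\<lambda>x. f x + h x) = \<mu> f + \<mu> h) \<and>
     (\<forall>f\<in>RUC_b. \<forall>c. \<mu> (\<lambda>x. c * f x) = c * \<mu> f) \<and>
     (\<forall>f\<in>RUC_b. (\<forall>x. 0 \<le> f x) \<longrightarrow> 0 \<le> \<mu> f) \<and>
     \<mu> (\<lambda>_. 1) = 1 \<and>
     (\<forall>f\<in>RUC_b. \<forall>g. \<mu> (f \<circ> (\<lambda>x. g + x)) = \<mu> f))"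


section \<open>Pseudo-metrics and moduli of maps\<close>

definition pseudo_metric :: "('a \<Rightarrow> 'a \<Rightarrow> real) \<Rightarrow> bool" where
  "pseudo_metric d \<longleftrightarrow>
     (\<forall>x y. 0 \<le> d x y) \<and> (\<forall>x. d x x = 0) \<and> (\<forall>x y. d x y = d y x) \<and>
     (\<forall>x y z. d x z \<le> d x y + d y z)"

definition left_invariant :: "('g::group_add \<Rightarrow> 'g \<Rightarrow> real) \<Rightarrow> bool" where
  "left_invariant d \<longleftrightarrow> (\<forall>g x y. d (g + x) (g + y) = d x y)"

definition continuous_pseudo_metric :: "('a::topological_space \<Rightarrow> 'a \<Rightarrow> real) \<Rightarrow> bool" where
  "continuous_pseudo_metric d \<longleftrightarrow> pseudo_metric d \<and> (\<forall>x r. open {y. d x y < r})"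

text \<open>In \<open>ennreal\<close> the supremum of the empty set is \<open>0\<close> and its infimum is \<open>\<infinity>\<close>, as in \<open>[0,\<infinity>]\<close>.\<close>

definition expansion_modulus ::
    "('a \<Rightarrow> 'a \<Rightarrow> real) \<Rightarrow> ('b \<Rightarrow> 'b \<Rightarrow> real) \<Rightarrow> ('a \<Rightarrow> 'b) \<Rightarrow> ennreal \<Rightarrow> ennreal" where
  "expansion_modulus dX dY \<sigma> t =
     Sup {ennreal (dY (\<sigma> x) (\<sigma> y)) | x y. ennreal (dX x y) \<le> t}"

definition exact_compression_modulus ::
    "('a \<Rightarrow> 'a \<Rightarrow> real) \<Rightarrow> ('b \<Rightarrow> 'b \<Rightarrow> real) \<Rightarrow> ('a \<Rightarrow> 'b) \<Rightarrow> ennreal \<Rightarrow> ennreal" where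
  "exact_compression_modulus dX dY \<sigma> t =
     Inf {ennreal (dY (\<sigma> x) (\<sigma> y)) | x y. ennreal (dX x y) = t}"

definition bornologous ::
    "('a \<Rightarrow> 'a \<Rightarrow> real) \<Rightarrow> ('b \<Rightarrow> 'b \<Rightarrow> real) \<Rightarrow> ('a \<Rightarrow> 'b) \<Rightarrow> bool" where
  "bornologous dX dY \<sigma> \<longleftrightarrow> (\<forall>t<\<infinity>. expansion_modulus dX dY \<sigma> t < \<infinity>)"

definition unif_continuous ::
    "('a \<Rightarrow> 'a \<Rightarrow> real) \<Rightarrow> ('b \<Rightarrow> 'b \<Rightarrow> real) \<Rightarrow> ('a \<Rightarrow> 'b) \<Rightarrow> bool" where
  "unif_continuous dX dY \<sigma> \<longleftrightarrow>
     (\<forall>\<epsilon>>0. \<exists>\<delta>>0. \<forall>x y. dX x y < \<delta> \<longrightarrow> dY (\<sigma> x) (\<sigma> y) < \<epsilon>)"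


section \<open>Normed spaces on a carrier set\<close>

text \<open>
  The Banach space whose existence is to be asserted cannot be a type, so it is a normed vector
  space on a carrier set. The vector space part is a module over the field of reals; the
  fields \<open>mult\<close> and \<open>one\<close> that the record \<open>module\<close> inherits from \<open>ring\<close> play no role.
\<close>

abbreviation real_field :: "real ring" where
  "real_field \<equiv> ring_of_type_algebra"

record 'x normed_space = "(real, 'x) module" +
  vnorm :: "'x \<Rightarrow> real"

text \<open>
  The locale \<open>Metric_space\<close> requires symmetry and nonnegativity on the whole type, hence the
  value \<open>0\<close> outside the carrier.
\<close>

definition norm_dist :: "'x normed_space \<Rightarrow> 'x \<Rightarrow> 'x \<Rightarrow> real" where
  "norm_dist V x y =
     (if x \<in> carrier V \<and> y \<in> carrier V then vnorm V (x \<ominus>\<^bsub>V\<^esub> y) else 0)"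

definition norm_topology :: "'x normed_space \<Rightarrow> 'x topology" where
  "norm_topology V = Metric_space.mtopology (carrier V) (norm_dist V)"

locale banach_space = Module.module real_field V for V :: "'x normed_space" +
  assumes norm_eq_zero: "x \<in> carrier V \<Longrightarrow> vnorm V x = 0 \<longleftrightarrow> x = \<zero>\<^bsub>V\<^esub>"
    and norm_smult: "x \<in> carrier V \<Longrightarrow> vnorm V (c \<odot>\<^bsub>V\<^esub> x) = \<bar>c\<bar> * vnorm V x"
    and norm_triangle:
      "x \<in> carrier V \<Longrightarrow> y \<in> carrier V \<Longrightarrow> vnorm V (x \<oplus>\<^bsub>V\<^esub> y) \<le> vnorm V x + vnorm V y"
    and complete: "Metric_space.mcomplete (carrier V) (norm_dist V)"

definition linear_on :: "'x set \<Rightarrow> 'x normed_space \<Rightarrow> 'y normed_space \<Rightarrow> ('x \<Rightarrow> 'y) \<Rightarrow> bool" where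
  "linear_on F V Y T \<longleftrightarrow>
     (\<forall>v\<in>F. T v \<in> carrier Y) \<and>
     (\<forall>v\<in>F. \<forall>w\<in>F. T (v \<oplus>\<^bsub>V\<^esub> w) = T v \<oplus>\<^bsub>Y\<^esub> T w) \<and>
     (\<forall>c. \<forall>v\<in>F. T (c \<odot>\<^bsub>V\<^esub> v) = c \<odot>\<^bsub>Y\<^esub> T v)"

definition op_norm_on ::
    "'x set \<Rightarrow> 'x normed_space \<Rightarrow> 'y normed_space \<Rightarrow> ('x \<Rightarrow> 'y) \<Rightarrow> ennreal" where
  "op_norm_on F V Y T = (SUP v\<in>{v \<in> F. vnorm V v \<le> 1}. ennreal (vnorm Y (T v)))"

definition finite_dim_subspace :: "'x normed_space \<Rightarrow> 'x set \<Rightarrow> bool" where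
  "finite_dim_subspace V F \<longleftrightarrow> submodule F real_field V \<and>
     (\<exists>B. finite B \<and> F = (\<lambda>W. submodule W real_field V) hull B)"

definition finitely_representable :: "'x normed_space \<Rightarrow> 'y normed_space \<Rightarrow> bool" where
  "finitely_representable V Y \<longleftrightarrow>
     (\<forall>F. \<forall>\<epsilon>::real. finite_dim_subspace V F \<and> 0 < \<epsilon> \<longrightarrow>
        (\<exists>T. linear_on F V Y T \<and> inj_on T F \<and>
             op_norm_on F V Y T < ennreal (1 + \<epsilon>) \<and>
             op_norm_on (T ` F) Y V (inv_into F T) < ennreal (1 + \<epsilon>)))"


section \<open>The space of Bochner \<open>p\<close>-integrable functions\<close>

text \<open>
  The library's Bochner integral is confined to second countable spaces. Here the values lie in an
  arbitrary Banach space, so measurability is the existence of an almost everywhere approximating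
  sequence of simple functions. Only values on \<open>[0,1]\<close> matter.
\<close>

definition bochner_measurable :: "(real \<Rightarrow> 'e::banach) \<Rightarrow> bool" where
  "bochner_measurable f \<longleftrightarrow>
     (\<exists>s :: nat \<Rightarrow> real \<Rightarrow> 'e.
        (\<forall>n. simple_function (lebesgue_on {0..1}) (s n)) \<and>
        (AE t in lebesgue_on {0..1}. (\<lambda>n. s n t) \<longlonglongrightarrow> f t))"

definition Lp_functions :: "real \<Rightarrow> (real \<Rightarrow> 'e::banach) set" where
  "Lp_functions p =
     {f. bochner_measurable f \<and> integrable (lebesgue_on {0..1}) (\<lambda>t. norm (f t) powr p)}"

definition Lp_class :: "real \<Rightarrow> (real \<Rightarrow> 'e::banach) \<Rightarrow> (real \<Rightarrow> 'e) set" where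
  "Lp_class p f = {g \<in> Lp_functions p. AE t in lebesgue_on {0..1}. g t = f t}"

definition Lp :: "real \<Rightarrow> (real \<Rightarrow> 'e::banach) set normed_space" where
  "Lp p = \<lparr>
     carrier = Lp_class p ` Lp_functions p,
     monoid.mult = undefined,
     one = undefined,
     ring.zero = Lp_class p (\<lambda>_. 0),
     add = (\<lambda>A B. \<Union>f\<in>A. \<Union>g\<in>B. Lp_class p (\<lambda>t. f t + g t)),
     smult = (\<lambda>c A. \<Union>f\<in>A. Lp_class p (\<lambda>t. c *\<^sub>R f t)),
     vnorm = (\<lambda>A. (\<integral>t. norm ((SOME f. f \<in> A) t) powr p \<partial>lebesgue_on {0..1}) powr (1 / p))\<rparr>"


section \<open>Isometric representations and cocycles\<close>

text \<open>Maps are total functions on the type; their values outside the carrier are irrelevant.\<close>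

definition Iso :: "'x normed_space \<Rightarrow> ('x \<Rightarrow> 'x) set" where
  "Iso V = {T. linear_on (carrier V) V V T \<and> T ` carrier V = carrier V \<and>
               (\<forall>v\<in>carrier V. vnorm V (T v) = vnorm V v)}"

definition strong_operator_topology :: "'x normed_space \<Rightarrow> ('x \<Rightarrow> 'x) topology" where
  "strong_operator_topology V =
     topology_generated_by
       {{T \<in> Iso V. T v \<in> W} | v W. v \<in> carrier V \<and> openin (norm_topology V) W}"

definition isometric_representation ::
    "'x normed_space \<Rightarrow> ('g::topological_group_add \<Rightarrow> 'x \<Rightarrow> 'x) \<Rightarrow> bool" where
  "isometric_representation V \<pi> \<longleftrightarrow>
     (\<forall>g. \<pi> g \<in> Iso V) \<and>
     (\<forall>g h. \<forall>v\<in>carrier V. \<pi> (g + h) v = \<pi> g (\<pi> h v)) \<and>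
     continuous_map euclidean (strong_operator_topology V) \<pi>"

definition is_cocycle ::
    "'x normed_space \<Rightarrow> ('g::group_add \<Rightarrow> 'x \<Rightarrow> 'x) \<Rightarrow> ('g \<Rightarrow> 'x) \<Rightarrow> bool" where
  "is_cocycle V \<pi> b \<longleftrightarrow>
     (\<forall>x. b x \<in> carrier V) \<and> (\<forall>x y. b (x + y) = \<pi> x (b y) \<oplus>\<^bsub>V\<^esub> b x)"

text \<open>
  HOL cannot quantify existentially over types, so the elements of the space to be constructed are
  taken from one fixed type. It is large enough: given any representation with the desired cocycles,
  the closed invariant subspace generated by one such cocycle for every function from the group
  \<open>G\<close> to \<open>E\<close> that admits one has density at most that of a set of size \<open>\<bar>G\<bar> \<cdot> \<bar>G \<Rightarrow> E\<bar>\<close>, and it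
  inherits finite representability. The elements are thought of as equivalence classes of Cauchy
  sequences of functions on \<open>G\<close> with values in \<open>E\<close>.
\<close>

type_synonym ('g, 'e) point = "(nat \<Rightarrow> 'g \<Rightarrow> 'e) set"

end

theory Submission
  imports Defs "HOL-Library.Function_Algebras"
begin

text \<open>
  Let \<open>\<mu>\<close> be an invariant mean. The bounded right uniformly continuous maps \<open>G \<rightarrow> E\<close> carry the
  seminorm \<open>\<mu> (\<parallel>f\<parallel>\<^sup>p)\<^bsup>1/p\<^esup>\<close>, which left translations preserve, and \<open>X\<close> is the completion of the
  quotient by its null space. For every admissible \<open>\<sigma>\<close> the map \<open>b g = (\<lambda>x. \<sigma> (x\<^sup>-\<^sup>1g) - \<sigma> (x\<^sup>-\<^sup>1))\<close> is a
  cocycle, and \<open>\<parallel>b g x - b h x\<parallel>\<close> lies between the two moduli at \<open>d (g, h)\<close> for every \<open>x\<close>, hence so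
  does its mean. Finite representability holds because \<open>\<mu>\<close> is approximated, on finitely many
  functions, by finite convex combinations of evaluations; such a combination is the integral along
  a step map \<open>\<phi> : [0,1] \<rightarrow> G\<close>, so that \<open>f \<mapsto> f \<circ> \<phi>\<close> almost embeds a given finite-dimensional
  subspace into \<open>L\<^sup>p(E)\<close>.
\<close>

text \<open>One space has to serve every \<open>d\<close> and \<open>\<sigma>\<close> at once.
  Therefore the seminorm depends on the mean alone, and \<open>d\<close> and \<open>\<sigma>\<close>
  enter only through the vectors \<open>b g\<close>. The map \<open>\<sigma>\<close> itself may be
  unbounded; being bornologous makes the differences bounded, and uniform continuity makes them
  right uniformly continuous. In the construction, completion precedes the quotient: Cauchy
  sequences form a vector space with the limit of the seminorms as seminorm, and a single quotient
  by null vectors yields classes of sequences. Linear algebra and translations thus live in an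
  ordinary vector space of functions. The mean need not come from a measure on the group. A convex
  combination of evaluations controls only finitely many functions, whereas an almost isometric
  embedding must control all vectors of a subspace. Compactness of the coefficient sphere bridges
  this: a finite net suffices, and linear independence modulo null vectors turns the additive error
  into a relative one.\<close>

instantiation "fun" :: (type, real_vector) real_vector
begin

definition scaleR_fun :: "real \<Rightarrow> ('a \<Rightarrow> 'b) \<Rightarrow> 'a \<Rightarrow> 'b" where
  "scaleR_fun c f = (\<lambda>x. c *\<^sub>R f x)"

instance
  by standard (simp_all add: scaleR_fun_def fun_eq_iff scaleR_add_right scaleR_add_left)

end

lemma scaleR_fun_apply [simp]: "(c *\<^sub>R f) x = c *\<^sub>R f x"
  by (simp add: scaleR_fun_def)

lemma sum_fun_apply: "(\<Sum>a\<in>A. f a) x = (\<Sum>a\<in>A. f a x)"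
  for f :: "'a \<Rightarrow> 'b \<Rightarrow> 'c::comm_monoid_add"
  by (induction A rule: infinite_finite_induct) auto

section \<open>Quotients of seminormed spaces\<close>

definition seminorm_class :: "'a::real_vector set \<Rightarrow> ('a \<Rightarrow> real) \<Rightarrow> 'a \<Rightarrow> 'a set" where
  "seminorm_class S N x = {y \<in> S. N (y - x) = 0}"

text \<open>Choosing representatives makes the operations total on arbitrary sets;
  \<open>add_quotient\<close>, \<open>smult_quotient\<close> and \<open>vnorm_quotient\<close> show
  that on classes the result does not depend on the choice.\<close>

definition seminorm_quotient :: "'a::real_vector set \<Rightarrow> ('a \<Rightarrow> real) \<Rightarrow> 'a set normed_space" where
  "seminorm_quotient S N = \<lparr>
     carrier = seminorm_class S N ` S,
     monoid.mult = undefined,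
     one = undefined,
     ring.zero = seminorm_class S N 0,
     add = (\<lambda>A B. seminorm_class S N ((SOME a. a \<in> A) + (SOME b. b \<in> B))),
     smult = (\<lambda>c A. seminorm_class S N (c *\<^sub>R (SOME a. a \<in> A))),
     vnorm = (\<lambda>A. N (SOME a. a \<in> A))\<rparr>"

text \<open>The axioms are relative to \<open>S\<close> because a mean is controlled only on
  \<open>RUC_b\<close>. The instances are \<open>Lp_mean\<close> on \<open>vector_RUC\<close>, for
  the given mean and for weighted means, and the limit seminorm on Cauchy sequences.\<close>

locale seminormed =
  fixes S :: "'a::real_vector set" and N :: "'a \<Rightarrow> real"
  assumes subspace: "subspace S"
    and triangle: "\<lbrakk>x \<in> S; y \<in> S\<rbrakk> \<Longrightarrow> N (x + y) \<le> N x + N y"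
    and scale: "x \<in> S \<Longrightarrow> N (c *\<^sub>R x) = \<bar>c\<bar> * N x"
begin

abbreviation cls where "cls \<equiv> seminorm_class S N"
abbreviation Q where "Q \<equiv> seminorm_quotient S N"

lemma closed [simp, intro]:
  shows "0 \<in> S" "\<lbrakk>x \<in> S; y \<in> S\<rbrakk> \<Longrightarrow> x + y \<in> S" "x \<in> S \<Longrightarrow> c *\<^sub>R x \<in> S"
    "\<lbrakk>x \<in> S; y \<in> S\<rbrakk> \<Longrightarrow> x - y \<in> S" "x \<in> S \<Longrightarrow> - x \<in> S"
  using subspace by (auto intro: subspace_0 subspace_add subspace_mul subspace_diff subspace_neg)

lemma sum_closed [intro]: "(\<And>b. b \<in> B \<Longrightarrow> f b \<in> S) \<Longrightarrow> (\<Sum>b\<in>B. f b) \<in> S"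
  by (rule subspace_sum[OF subspace])

lemma zero [simp]: "N 0 = 0"
  using scale[of 0 0] by simp

lemma minus_commute: "x - y \<in> S \<Longrightarrow> N (y - x) = N (x - y)"
  using scale[of "x - y" "-1"] by simp

lemma nonneg: "x \<in> S \<Longrightarrow> 0 \<le> N x"
  using triangle[of x "- x"] scale[of x "-1"] by (simp add: scaleR_minus1_left)

lemma triangle3: "\<lbrakk>x \<in> S; y \<in> S; z \<in> S\<rbrakk> \<Longrightarrow> N (x - z) \<le> N (x - y) + N (y - z)"
  using triangle[of "x - y" "y - z"] by simp

lemma abs_diff: "\<lbrakk>x \<in> S; y \<in> S\<rbrakk> \<Longrightarrow> \<bar>N x - N y\<bar> \<le> N (x - y)"
  using triangle[of "x - y" y] triangle[of "y - x" x] minus_commute[of x y] by force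

lemma sum_le: "(\<And>b. b \<in> B \<Longrightarrow> f b \<in> S) \<Longrightarrow> N (\<Sum>b\<in>B. f b) \<le> (\<Sum>b\<in>B. N (f b))"
proof (induction B rule: infinite_finite_induct)
  case (insert b B)
  then have "N (f b + (\<Sum>b\<in>B. f b)) \<le> N (f b) + N (\<Sum>b\<in>B. f b)"
    by (intro triangle) auto
  with insert show ?case
    by fastforce
qed auto

section \<open>Classes, operations and the distance on the quotient\<close>

lemma class_self: "x \<in> S \<Longrightarrow> x \<in> cls x"
  by (simp add: seminorm_class_def)

lemma class_eq_iff:
  assumes "x \<in> S" "y \<in> S"
  shows "cls x = cls y \<longleftrightarrow> N (x - y) = 0"
proof
  assume "cls x = cls y"
  with class_self[OF assms(1)] have "x \<in> cls y"
    by simp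
  then show "N (x - y) = 0"
    by (simp add: seminorm_class_def)
next
  assume xy: "N (x - y) = 0"
  have "N (z - x) = 0 \<longleftrightarrow> N (z - y) = 0" if "z \<in> S" for z
    using triangle3[of z x y] triangle3[of z y x] minus_commute[of x y] xy assms that
      nonneg[of "z - x"] nonneg[of "z - y"] by auto
  then show "cls x = cls y"
    by (auto simp: seminorm_class_def)
qed

lemma some_class:
  assumes "x \<in> S"
  shows "(SOME a. a \<in> cls x) \<in> S" "N ((SOME a. a \<in> cls x) - x) = 0"
proof -
  have "(SOME a. a \<in> cls x) \<in> cls x"
    using class_self[OF assms] by (rule someI)
  then show "(SOME a. a \<in> cls x) \<in> S" "N ((SOME a. a \<in> cls x) - x) = 0"
    by (auto simp: seminorm_class_def)
qed

lemma carrier_quotient: "carrier Q = cls ` S"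
  by (simp add: seminorm_quotient_def)

lemma class_carrier [simp, intro]: "x \<in> S \<Longrightarrow> cls x \<in> carrier Q"
  by (simp add: carrier_quotient)

lemma carrier_cases:
  assumes "A \<in> carrier Q" obtains x where "x \<in> S" "A = cls x"
  using assms by (auto simp: carrier_quotient)

lemma zero_quotient: "\<zero>\<^bsub>Q\<^esub> = cls 0"
  by (simp add: seminorm_quotient_def)

lemma add_quotient:
  assumes "x \<in> S" "y \<in> S"
  shows "cls x \<oplus>\<^bsub>Q\<^esub> cls y = cls (x + y)"
proof -
  let ?x = "SOME a. a \<in> cls x" and ?y = "SOME a. a \<in> cls y"
  note xy = some_class[OF assms(1)] some_class[OF assms(2)]
  have "N ((?x + ?y) - (x + y)) \<le> N (?x - x) + N (?y - y)"
    using triangle[of "?x - x" "?y - y"] xy assms by (simp add: algebra_simps)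
  then have "N ((?x + ?y) - (x + y)) = 0"
    using nonneg[of "(?x + ?y) - (x + y)"] xy assms by auto
  then show ?thesis
    using xy assms by (simp add: seminorm_quotient_def class_eq_iff)
qed

lemma smult_quotient:
  assumes "x \<in> S"
  shows "c \<odot>\<^bsub>Q\<^esub> cls x = cls (c *\<^sub>R x)"
proof -
  let ?x = "SOME a. a \<in> cls x"
  note x = some_class[OF assms]
  have "N (c *\<^sub>R ?x - c *\<^sub>R x) = 0"
    using scale[of "?x - x" c] x assms by (simp add: scaleR_diff_right)
  then show ?thesis
    using x assms by (simp add: seminorm_quotient_def class_eq_iff)
qed

lemma vnorm_quotient:
  assumes "x \<in> S"
  shows "vnorm Q (cls x) = N x"
  using abs_diff[OF some_class(1)[OF assms] assms] some_class[OF assms]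
  by (simp add: seminorm_quotient_def)

lemma abelian_group_quotient: "abelian_group Q"
proof (rule abelian_groupI)
  fix A B C assume "A \<in> carrier Q" "B \<in> carrier Q" "C \<in> carrier Q"
  then obtain x y z where "x \<in> S" "y \<in> S" "z \<in> S" "A = cls x" "B = cls y" "C = cls z"
    by (metis carrier_cases)
  then show "A \<oplus>\<^bsub>Q\<^esub> B \<oplus>\<^bsub>Q\<^esub> C = A \<oplus>\<^bsub>Q\<^esub> (B \<oplus>\<^bsub>Q\<^esub> C)"
    by (simp add: add_quotient add.assoc)
next
  fix A assume "A \<in> carrier Q"
  then obtain x where x: "x \<in> S" "A = cls x"
    by (rule carrier_cases)
  show "\<exists>B\<in>carrier Q. B \<oplus>\<^bsub>Q\<^esub> A = \<zero>\<^bsub>Q\<^esub>"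
    by (rule bexI[of _ "cls (- x)"]) (use x in \<open>auto simp: add_quotient zero_quotient\<close>)
qed (auto elim!: carrier_cases simp: add_quotient zero_quotient add.commute)

sublocale quotient: Module.module real_field Q
proof (rule moduleI)
  show "cring (real_field :: real ring)"
    by (rule cring_from_type_algebra)
  show "abelian_group Q"
    by (rule abelian_group_quotient)
qed (auto elim!: carrier_cases
    simp: add_quotient smult_quotient scaleR_add_left scaleR_add_right ring_of_type_algebra_def)

lemma minus_quotient:
  assumes "x \<in> S" "y \<in> S"
  shows "cls x \<ominus>\<^bsub>Q\<^esub> cls y = cls (x - y)"
proof -
  have "\<ominus>\<^bsub>Q\<^esub> cls y = cls (- y)"
    by (rule quotient.minus_equality) (use assms in \<open>auto simp: add_quotient zero_quotient\<close>)
  then show ?thesis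
    using assms by (simp add: a_minus_def add_quotient)
qed

lemma norm_dist_quotient:
  assumes "x \<in> S" "y \<in> S"
  shows "norm_dist Q (cls x) (cls y) = N (x - y)"
  using assms by (simp add: norm_dist_def minus_quotient vnorm_quotient)

sublocale quotient_metric: Metric_space "carrier Q" "norm_dist Q"
proof
  show "0 \<le> norm_dist Q A B" for A B
    by (cases "A \<in> carrier Q \<and> B \<in> carrier Q")
      (auto elim!: carrier_cases simp: norm_dist_quotient intro!: nonneg, auto simp: norm_dist_def)
  show "norm_dist Q A B = norm_dist Q B A" for A B
    by (cases "A \<in> carrier Q \<and> B \<in> carrier Q")
      (auto elim!: carrier_cases simp: norm_dist_quotient intro!: minus_commute,
        auto simp: norm_dist_def)
  show "norm_dist Q A B = 0 \<longleftrightarrow> A = B" if "A \<in> carrier Q" "B \<in> carrier Q" for A B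
    using that by (elim carrier_cases) (simp add: norm_dist_quotient class_eq_iff)
qed (auto elim!: carrier_cases simp: norm_dist_quotient intro: triangle3)

lemma openin_norm_topologyD:
  assumes "openin (norm_topology Q) W" "x \<in> S" "cls x \<in> W"
  obtains e where "e > 0" "\<And>y. \<lbrakk>y \<in> S; N (x - y) < e\<rbrakk> \<Longrightarrow> cls y \<in> W"
proof -
  obtain e where "e > 0" and W: "quotient_metric.mball (cls x) e \<subseteq> W"
    using assms by (auto simp: norm_topology_def quotient_metric.openin_mtopology)
  have "cls y \<in> W" if "y \<in> S" "N (x - y) < e" for y
    by (rule subsetD[OF W]) (use that assms(2) in \<open>simp add: norm_dist_quotient\<close>)
  then show ?thesis
    using that \<open>e > 0\<close> by blast
qed

text \<open>The distance of two classes is the seminorm of the difference of any representatives.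
  Hence a Cauchy sequence of classes lifts term by term to a sequence that is Cauchy for
  \<open>N\<close>, and a limit upstairs gives one downstairs.\<close>

lemma banach_space_quotient:
  assumes complete: "\<And>s. \<lbrakk>\<And>n. s n \<in> S; \<And>e. e > 0 \<Longrightarrow> \<exists>M. \<forall>m\<ge>M. \<forall>n\<ge>M. N (s m - s n) < e\<rbrakk>
    \<Longrightarrow> \<exists>x\<in>S. (\<lambda>n. N (s n - x)) \<longlonglongrightarrow> 0"
  shows "banach_space Q"
proof
  show "quotient_metric.mcomplete"
    unfolding quotient_metric.mcomplete_def
  proof (intro allI impI)
    fix \<sigma> assume \<sigma>: "quotient_metric.MCauchy \<sigma>"
    then have "range \<sigma> \<subseteq> carrier Q"
      by (simp add: quotient_metric.MCauchy_def)
    then have "range \<sigma> \<subseteq> cls ` S"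
      by (simp add: carrier_quotient)
    then have "\<forall>n. \<exists>x. x \<in> S \<and> \<sigma> n = cls x"
      by blast
    then obtain s where s: "\<And>n. s n \<in> S" "\<And>n. \<sigma> n = cls (s n)"
      by metis
    have "\<exists>M. \<forall>m\<ge>M. \<forall>n\<ge>M. N (s m - s n) < e" if "e > 0" for e
      using \<sigma> that by (auto simp: quotient_metric.MCauchy_def s norm_dist_quotient)
    with complete[of s] s(1) obtain x where x: "x \<in> S" "(\<lambda>n. N (s n - x)) \<longlonglongrightarrow> 0"
      by auto
    have "limitin quotient_metric.mtopology \<sigma> (cls x) sequentially"
      unfolding quotient_metric.limitin_metric
      using x s order_tendstoD(2)[OF x(2)] by (simp add: norm_dist_quotient)
    then show "\<exists>x. limitin quotient_metric.mtopology \<sigma> x sequentially"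
      by blast
  qed
  show "vnorm Q A = 0 \<longleftrightarrow> A = \<zero>\<^bsub>Q\<^esub>" if "A \<in> carrier Q" for A
    using that by (elim carrier_cases) (simp add: vnorm_quotient zero_quotient class_eq_iff)
qed (auto elim!: carrier_cases simp: vnorm_quotient smult_quotient add_quotient scale triangle)

text \<open>Surjectivity and invariance of the seminorm make the direct image of a class a full
  class. A linear isometry thus acts on the quotient by plain image of sets, without choice of
  representatives, and composition of maps becomes composition of images.\<close>

lemma image_class:
  assumes "linear \<tau>" "\<tau> ` S = S" "\<And>x. x \<in> S \<Longrightarrow> N (\<tau> x) = N x" "x \<in> S"
  shows "\<tau> ` cls x = cls (\<tau> x)"
proof -
  have "N (\<tau> y - \<tau> x) = N (y - x)" if "y \<in> S" for y
    using assms that by (metis closed(4) linear_diff)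
  then have "\<tau> ` {y \<in> S. N (y - x) = 0} = {z \<in> \<tau> ` S. N (z - \<tau> x) = 0}"
    by auto
  then show ?thesis
    using assms(2) by (simp add: seminorm_class_def)
qed

lemma image_in_Iso:
  assumes "linear \<tau>" "\<tau> ` S = S" "\<And>x. x \<in> S \<Longrightarrow> N (\<tau> x) = N x"
  shows "(\<lambda>A. \<tau> ` A) \<in> Iso Q"
proof -
  note im = image_class[OF assms]
  have \<tau>: "\<tau> x \<in> S" if "x \<in> S" for x
    using assms(2) that by blast
  have "linear_on (carrier Q) Q Q ((`) \<tau>)"
    unfolding linear_on_def
    by (intro conjI ballI allI; elim carrier_cases)
      (simp_all add: im \<tau> add_quotient smult_quotient
        linear_add[OF assms(1)] linear_scale[OF assms(1)])
  moreover have "(`) \<tau> ` carrier Q = carrier Q"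
  proof -
    have "(`) \<tau> ` carrier Q = cls ` \<tau> ` S"
      unfolding carrier_quotient image_image using im by auto
    then show ?thesis
      using assms(2) by (simp add: carrier_quotient)
  qed
  moreover have "vnorm Q (\<tau> ` A) = vnorm Q A" if "A \<in> carrier Q" for A
    using that by (auto elim!: carrier_cases simp: im \<tau> vnorm_quotient assms(3))
  ultimately show ?thesis
    by (simp add: Iso_def)
qed

text \<open>The strong operator topology is generated by conditions on single vectors, so continuity
  amounts to openness of the preimages of these sets; \<open>cont\<close> supplies it on
  representatives around each point \<open>g\<close>.\<close>

lemma isometric_representation_quotient:
  fixes \<tau> :: "'g::topological_group_add \<Rightarrow> 'a \<Rightarrow> 'a"
  assumes lin: "\<And>g. linear (\<tau> g)" and onto: "\<And>g. \<tau> g ` S = S"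
    and iso: "\<And>g x. x \<in> S \<Longrightarrow> N (\<tau> g x) = N x"
    and hom: "\<And>g h x. \<tau> (g + h) x = \<tau> g (\<tau> h x)"
    and cont: "\<And>g x e. \<lbrakk>x \<in> S; e > 0\<rbrakk> \<Longrightarrow> \<exists>U. open U \<and> g \<in> U \<and> (\<forall>h\<in>U. N (\<tau> g x - \<tau> h x) < e)"
  shows "isometric_representation Q (\<lambda>g A. \<tau> g ` A)"
proof -
  let ?\<pi> = "\<lambda>g A. \<tau> g ` A"
  have Iso: "?\<pi> g \<in> Iso Q" for g
    using image_in_Iso[OF lin onto iso] .
  have \<tau>: "\<tau> g x \<in> S" if "x \<in> S" for g x
    using onto that by blast
  have "open {g. ?\<pi> g A \<in> W}" if "A \<in> carrier Q" "openin (norm_topology Q) W" for A W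
    unfolding open_subopen[of "{g. ?\<pi> g A \<in> W}"]
  proof
    fix g assume "g \<in> {g. ?\<pi> g A \<in> W}"
    moreover obtain x where x: "x \<in> S" "A = cls x"
      using \<open>A \<in> carrier Q\<close> by (rule carrier_cases)
    moreover have im: "?\<pi> h A = cls (\<tau> h x)" for h
      using image_class[OF lin onto iso] x by simp
    ultimately have "cls (\<tau> g x) \<in> W"
      by simp
    then obtain e where "e > 0" "\<And>y. \<lbrakk>y \<in> S; N (\<tau> g x - y) < e\<rbrakk> \<Longrightarrow> cls y \<in> W"
      using openin_norm_topologyD \<open>openin (norm_topology Q) W\<close> \<tau>[OF x(1)] by metis
    with cont[OF x(1), of e g] \<tau>[OF x(1)]
    show "\<exists>T. open T \<and> g \<in> T \<and> T \<subseteq> {g. ?\<pi> g A \<in> W}"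
      unfolding im by blast
  qed
  \<comment> \<open>The generating sets must cover \<open>Iso Q\<close> for it to lie in the
    underlying set of the topology: the class of 0 and the whole carrier as \<open>W\<close> already
    give all of it.\<close>
  moreover have "Iso Q \<in> {{T \<in> Iso Q. T v \<in> W} | v W. v \<in> carrier Q \<and> openin (norm_topology Q) W}"
  proof -
    have "openin (norm_topology Q) (carrier Q)"
      by (metis norm_topology_def openin_topspace quotient_metric.topspace_mtopology)
    moreover have "T (cls 0) \<in> carrier Q" if "T \<in> Iso Q" for T
      using that closed(1) class_carrier unfolding Iso_def by blast
    ultimately show ?thesis
      using closed(1) class_carrier by blast
  qed
  then have "Iso Q \<subseteq> topspace (strong_operator_topology Q)"
    unfolding strong_operator_topology_def topology_generated_by_topspace by blast
  ultimately have "continuous_map euclidean (strong_operator_topology Q) ?\<pi>"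
    unfolding strong_operator_topology_def
    by (intro continuous_on_generated_topo) (use Iso in \<open>auto simp: vimage_def\<close>)
  then show ?thesis
    unfolding isometric_representation_def using Iso hom by (auto simp: image_image)
qed

end

section \<open>Completion by Cauchy sequences\<close>

definition cauchy_sequences :: "'a::real_vector set \<Rightarrow> ('a \<Rightarrow> real) \<Rightarrow> (nat \<Rightarrow> 'a) set" where
  "cauchy_sequences S N =
     {s. (\<forall>n. s n \<in> S) \<and> (\<forall>e>0. \<exists>M. \<forall>m\<ge>M. \<forall>n\<ge>M. N (s m - s n) < e)}"

definition limit_seminorm :: "('a \<Rightarrow> real) \<Rightarrow> (nat \<Rightarrow> 'a) \<Rightarrow> real" where
  "limit_seminorm N s = lim (\<lambda>n. N (s n))"

context seminormed
begin

abbreviation C where "C \<equiv> cauchy_sequences S N"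
abbreviation L where "L \<equiv> limit_seminorm N"

lemma C_closed: "s \<in> C \<Longrightarrow> s n \<in> S"
  by (simp add: cauchy_sequences_def)

lemma C_Cauchy: "\<lbrakk>s \<in> C; e > 0\<rbrakk> \<Longrightarrow> \<exists>M. \<forall>m\<ge>M. \<forall>n\<ge>M. N (s m - s n) < e"
  by (simp add: cauchy_sequences_def)

lemma const_in_C: "x \<in> S \<Longrightarrow> (\<lambda>_. x) \<in> C"
  by (simp add: cauchy_sequences_def)

lemma limit_seminorm_const: "L (\<lambda>_. x) = N x"
  by (simp add: limit_seminorm_def)

lemma limit_seminorm_LIMSEQ:
  assumes "s \<in> C"
  shows "(\<lambda>n. N (s n)) \<longlonglongrightarrow> L s"
proof -
  have "Cauchy (\<lambda>n. N (s n))"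
  proof (rule metric_CauchyI)
    fix e :: real assume "e > 0"
    then obtain M where "\<forall>m\<ge>M. \<forall>n\<ge>M. N (s m - s n) < e"
      using C_Cauchy assms by blast
    then show "\<exists>M. \<forall>m\<ge>M. \<forall>n\<ge>M. dist (N (s m)) (N (s n)) < e"
      unfolding dist_real_def using abs_diff C_closed[OF assms] by (meson order.strict_trans1)
  qed
  then show ?thesis
    by (simp add: limit_seminorm_def Cauchy_convergent flip: convergent_LIMSEQ_iff)
qed

lemma subspace_C: "subspace C"
  unfolding subspace_def
proof (intro conjI ballI allI)
  show "0 \<in> C"
    by (simp add: cauchy_sequences_def)
next
  fix s t assume st: "s \<in> C" "t \<in> C"
  have "\<exists>M. \<forall>m\<ge>M. \<forall>n\<ge>M. N ((s + t) m - (s + t) n) < e" if "e > 0" for e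
  proof -
    have "e / 2 > 0"
      using that by simp
    then obtain M M' where M: "\<And>m n. \<lbrakk>m \<ge> M; n \<ge> M\<rbrakk> \<Longrightarrow> N (s m - s n) < e / 2"
      "\<And>m n. \<lbrakk>m \<ge> M'; n \<ge> M'\<rbrakk> \<Longrightarrow> N (t m - t n) < e / 2"
      using C_Cauchy[OF st(1)] C_Cauchy[OF st(2)] by metis
    have "N ((s + t) m - (s + t) n) < e" if "m \<ge> max M M'" "n \<ge> max M M'" for m n
      using triangle[of "s m - s n" "t m - t n"] M(1)[of m n] M(2)[of m n] that
        C_closed[OF st(1)] C_closed[OF st(2)]
      by (simp add: algebra_simps)
    then show ?thesis
      by blast
  qed
  then show "s + t \<in> C"
    using st by (auto simp: cauchy_sequences_def)
next
  fix c s assume s: "s \<in> C"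
  have "\<exists>M. \<forall>m\<ge>M. \<forall>n\<ge>M. N ((c *\<^sub>R s) m - (c *\<^sub>R s) n) < e" if "e > 0" for e
  proof -
    have pos: "0 < \<bar>c\<bar> + 1"
      by linarith
    then obtain M where M: "\<And>m n. \<lbrakk>m \<ge> M; n \<ge> M\<rbrakk> \<Longrightarrow> N (s m - s n) < e / (\<bar>c\<bar> + 1)"
      using C_Cauchy[OF s, of "e / (\<bar>c\<bar> + 1)"] \<open>e > 0\<close> by auto
    have "N ((c *\<^sub>R s) m - (c *\<^sub>R s) n) < e" if "m \<ge> M" "n \<ge> M" for m n
    proof -
      have "N ((c *\<^sub>R s) m - (c *\<^sub>R s) n) = \<bar>c\<bar> * N (s m - s n)"
        using scale[of "s m - s n" c] C_closed[OF s] by (simp add: scaleR_diff_right)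
      also have "\<dots> \<le> (\<bar>c\<bar> + 1) * N (s m - s n)"
        using C_closed[OF s] by (intro mult_right_mono nonneg) auto
      also have "\<dots> < e"
        using M[OF that] pos by (simp add: field_simps)
      finally show ?thesis .
    qed
    then show ?thesis
      by blast
  qed
  then show "c *\<^sub>R s \<in> C"
    using s by (auto simp: cauchy_sequences_def)
qed

lemma seminormed_completion: "seminormed C L"
proof
  show "subspace C"
    by (rule subspace_C)
next
  fix s t assume st: "s \<in> C" "t \<in> C"
  show "L (s + t) \<le> L s + L t"
  proof (rule LIMSEQ_le)
    show "(\<lambda>n. N ((s + t) n)) \<longlonglongrightarrow> L (s + t)"
      using subspace_add[OF subspace_C st] by (rule limit_seminorm_LIMSEQ)
    show "(\<lambda>n. N (s n) + N (t n)) \<longlonglongrightarrow> L s + L t"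
      using st by (intro tendsto_add limit_seminorm_LIMSEQ)
  qed (use st in \<open>auto intro: triangle C_closed\<close>)
next
  fix s c assume s: "s \<in> C"
  have "(\<lambda>n. N ((c *\<^sub>R s) n)) \<longlonglongrightarrow> \<bar>c\<bar> * L s"
    using tendsto_mult_left[OF limit_seminorm_LIMSEQ[OF s]] C_closed[OF s] by (simp add: scale)
  then show "L (c *\<^sub>R s) = \<bar>c\<bar> * L s"
    using limit_seminorm_LIMSEQ[OF subspace_mul[OF subspace_C s]] LIMSEQ_unique by blast
qed

text \<open>Density of the constant sequences, which are the copy of \<open>S\<close> in the
  completion. Every late index works, so that finitely many sequences can later be replaced by their
  terms at one common index.\<close>

lemma limit_seminorm_approx:
  assumes "s \<in> C" "e > 0"
  shows "\<exists>M. \<forall>m\<ge>M. L (s - (\<lambda>_. s m)) < e"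
proof -
  interpret completion: seminormed C L
    by (rule seminormed_completion)
  obtain M where M: "\<And>m n. \<lbrakk>m \<ge> M; n \<ge> M\<rbrakk> \<Longrightarrow> N (s m - s n) < e / 2"
    using C_Cauchy[OF assms(1), of "e / 2"] assms(2) by auto
  have "L (s - (\<lambda>_. s m)) < e" if "m \<ge> M" for m
  proof -
    have "s - (\<lambda>_. s m) \<in> C"
      using assms C_closed const_in_C by blast
    then have "L (s - (\<lambda>_. s m)) \<le> e / 2"
      using M that
      by (intro LIMSEQ_le_const2[OF limit_seminorm_LIMSEQ]) (auto intro!: exI[of _ M] less_imp_le)
    then show ?thesis
      using assms by linarith
  qed
  then show ?thesis
    by blast
qed

text \<open>Diagonal argument: \<open>t k\<close> is a term of \<open>s k\<close> whose constant
  sequence is within \<open>1 / (k + 1)\<close> of \<open>s k\<close>. These constants inherit the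
  Cauchy property from \<open>s\<close>, so \<open>t\<close> itself lies in \<open>C\<close> and is
  the limit.\<close>

lemma completion_complete:
  fixes s :: "nat \<Rightarrow> nat \<Rightarrow> 'a"
  assumes s: "\<And>n. s n \<in> C" and "\<And>e. e > 0 \<Longrightarrow> \<exists>M. \<forall>m\<ge>M. \<forall>n\<ge>M. L (s m - s n) < e"
  shows "\<exists>t\<in>C. (\<lambda>n. L (s n - t)) \<longlonglongrightarrow> 0"
proof -
  interpret completion: seminormed C L
    by (rule seminormed_completion)
  have "\<exists>m. L (s k - (\<lambda>_. s k m)) < inverse (real (Suc k))" for k
    using limit_seminorm_approx[OF s, of "inverse (real (Suc k))" k] by auto
  then obtain r where r: "\<And>k. L (s k - (\<lambda>_. s k (r k))) < inverse (real (Suc k))"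
    by metis
  define t where "t k = s k (r k)" for k
  have tS: "t k \<in> S" for k
    unfolding t_def by (rule C_closed[OF s])
  have st: "(\<lambda>k. L (s k - (\<lambda>_. t k))) \<longlonglongrightarrow> 0"
  proof (rule tendsto_sandwich[OF _ _ tendsto_const LIMSEQ_inverse_real_of_nat])
    show "\<forall>\<^sub>F k in sequentially. 0 \<le> L (s k - (\<lambda>_. t k))"
      using s tS const_in_C by (auto intro!: always_eventually completion.nonneg)
    show "\<forall>\<^sub>F k in sequentially. L (s k - (\<lambda>_. t k)) \<le> inverse (real (Suc k))"
      using r unfolding t_def by (auto intro!: always_eventually less_imp_le)
  qed
  have "t \<in> C"
    unfolding cauchy_sequences_def
  proof (intro CollectI conjI allI impI tS)
    fix e :: real assume "e > 0"
    then obtain M where M: "\<And>m n. \<lbrakk>m \<ge> M; n \<ge> M\<rbrakk> \<Longrightarrow> L (s m - s n) < e / 3"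
      using assms(2)[of "e / 3"] by auto
    obtain M' where M': "\<And>k. k \<ge> M' \<Longrightarrow> L (s k - (\<lambda>_. t k)) < e / 3"
      using order_tendstoD(2)[OF st, of "e / 3"] \<open>e > 0\<close> by (auto simp: eventually_sequentially)
    have "N (t m - t n) < e" if "m \<ge> max M M'" "n \<ge> max M M'" for m n
    proof -
      let ?m = "\<lambda>_. t m" and ?n = "\<lambda>_. t n"
      have C: "?m \<in> C" "?n \<in> C" "s m \<in> C" "s n \<in> C"
        using s tS const_in_C by auto
      \<comment> \<open>Constant sequences move the estimate into the completion, where
        \<open>s m\<close> and \<open>s n\<close> serve as intermediate points.\<close>
      have "N (t m - t n) = L (?m - ?n)"
        by (simp add: fun_diff_def limit_seminorm_const)
      also have "\<dots> \<le> L (?m - s m) + (L (s m - s n) + L (s n - ?n))"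
        using completion.triangle3[of ?m "s m" ?n] completion.triangle3[of "s m" "s n" ?n] C
        by linarith
      also have "\<dots> < e"
        using M[of m n] M'[of m] M'[of n] that completion.minus_commute[of "s m" ?m] C by auto
      finally show ?thesis .
    qed
    then show "\<exists>M. \<forall>m\<ge>M. \<forall>n\<ge>M. N (t m - t n) < e"
      by blast
  qed
  moreover have "(\<lambda>k. L (s k - t)) \<longlonglongrightarrow> 0"
  proof (rule LIMSEQ_I)
    fix e :: real assume "e > 0"
    then obtain M where M: "\<And>m. m \<ge> M \<Longrightarrow> L (t - (\<lambda>_. t m)) < e / 2"
      using limit_seminorm_approx[OF \<open>t \<in> C\<close>, of "e / 2"] by auto
    obtain M' where M': "\<And>k. k \<ge> M' \<Longrightarrow> L (s k - (\<lambda>_. t k)) < e / 2"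
      using order_tendstoD(2)[OF st, of "e / 2"] \<open>e > 0\<close> by (auto simp: eventually_sequentially)
    have "norm (L (s k - t) - 0) < e" if "k \<ge> max M M'" for k
    proof -
      have C: "(\<lambda>_. t k) \<in> C" "t \<in> C" "s k \<in> C"
        using s tS const_in_C \<open>t \<in> C\<close> by auto
      have "L (s k - t) \<le> L (s k - (\<lambda>_. t k)) + L ((\<lambda>_. t k) - t)"
        using C by (intro completion.triangle3)
      moreover have "L ((\<lambda>_. t k) - t) = L (t - (\<lambda>_. t k))"
        using C by (intro completion.minus_commute) auto
      ultimately show ?thesis
        using M[of k] M'[of k] that C completion.nonneg[of "s k - t"] by auto
    qed
    then show "\<exists>no. \<forall>k\<ge>no. norm (L (s k - t) - 0) < e"
      by blast
  qed
  ultimately show ?thesis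
    by blast
qed

end

section \<open>Finite-dimensional subspaces\<close>

text \<open>Coefficient families are functions on the whole index type. Vanishing off
  \<open>B\<close> confines the sphere to a product of compact intervals, compact by Tychonoff, in
  which it is closed.\<close>

lemma compact_coefficient_sphere:
  assumes "finite B"
  shows "compact {c :: 'i \<Rightarrow> real. (\<forall>b. b \<notin> B \<longrightarrow> c b = 0) \<and> (\<Sum>b\<in>B. \<bar>c b\<bar>) = 1}"
    (is "compact ?K")
proof -
  let ?I = "\<lambda>b. if b \<in> B then {-1..1::real} else {0}"
  have "compactin (product_topology (\<lambda>_. euclidean) UNIV) (PiE UNIV ?I)"
    unfolding compactin_PiE by auto
  then have "compact (PiE UNIV ?I)"
    unfolding euclidean_product_topology by simp
  moreover have "closed {c :: 'i \<Rightarrow> real. (\<Sum>b\<in>B. \<bar>c b\<bar>) = 1}"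
    by (intro closed_Collect_eq continuous_intros continuous_on_product_coordinates)
  ultimately have "compact (PiE UNIV ?I \<inter> {c. (\<Sum>b\<in>B. \<bar>c b\<bar>) = 1})"
    by (rule compact_Int_closed)
  also have "PiE UNIV ?I \<inter> {c. (\<Sum>b\<in>B. \<bar>c b\<bar>) = 1} = ?K"
  proof -
    have "\<bar>c b\<bar> \<le> 1" if "b \<in> B" "(\<Sum>b\<in>B. \<bar>c b\<bar>) = 1" for b and c :: "'i \<Rightarrow> real"
      using member_le_sum[OF that(1), of "\<lambda>b. \<bar>c b\<bar>"] that assms by auto
    then show ?thesis
      by (auto simp: PiE_UNIV_domain abs_le_iff split: if_splits)
  qed
  finally show ?thesis .
qed

lemma sum_abs_normalized:
  fixes c :: "'i \<Rightarrow> real"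
  assumes "(\<Sum>b\<in>B. \<bar>c b\<bar>) > 0"
  shows "(\<Sum>b\<in>B. \<bar>c b / (\<Sum>b\<in>B. \<bar>c b\<bar>)\<bar>) = 1"
proof -
  define s where "s = (\<Sum>b\<in>B. \<bar>c b\<bar>)"
  have "(\<Sum>b\<in>B. \<bar>c b / s\<bar>) = (\<Sum>b\<in>B. \<bar>c b\<bar> / s)"
    using assms by (simp add: s_def abs_divide)
  also have "\<dots> = s / s"
    unfolding s_def by (rule sum_divide_distrib[symmetric])
  finally show ?thesis
    using assms by (simp add: s_def)
qed

lemma finite_coefficient_net:
  fixes e :: real
  assumes "finite B" "e > 0"
  obtains D :: "('i \<Rightarrow> real) set" where "finite D" "\<And>c. c \<in> D \<Longrightarrow> (\<Sum>b\<in>B. \<bar>c b\<bar>) = 1"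
    "\<And>c. (\<Sum>b\<in>B. \<bar>c b\<bar>) = 1 \<Longrightarrow> \<exists>c'\<in>D. (\<Sum>b\<in>B. \<bar>c b - c' b\<bar>) < e"
proof -
  let ?K = "{c :: 'i \<Rightarrow> real. (\<forall>b. b \<notin> B \<longrightarrow> c b = 0) \<and> (\<Sum>b\<in>B. \<bar>c b\<bar>) = 1}"
  let ?U = "\<lambda>c'. {c :: 'i \<Rightarrow> real. (\<Sum>b\<in>B. \<bar>c b - c' b\<bar>) < e}"
  have "open (?U c')" if "c' \<in> ?K" for c'
    by (intro open_Collect_less continuous_intros continuous_on_product_coordinates)
  moreover have "?K \<subseteq> (\<Union>c'\<in>?K. ?U c')"
    using \<open>e > 0\<close> by (auto intro!: exI)
  ultimately obtain D where D: "D \<subseteq> ?K" "finite D" "?K \<subseteq> (\<Union>c'\<in>D. ?U c')"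
    by (rule compactE_image[OF compact_coefficient_sphere[OF assms(1)]])
  show ?thesis
  proof
    fix c :: "'i \<Rightarrow> real" assume c: "(\<Sum>b\<in>B. \<bar>c b\<bar>) = 1"
    \<comment> \<open>The given \<open>c\<close> is arbitrary off \<open>B\<close>, whereas members
      of \<open>?K\<close> vanish there; truncation changes none of the sums over
      \<open>B\<close>.\<close>
    have "(\<lambda>b. if b \<in> B then c b else 0) \<in> ?K"
      using c by simp
    then have "(\<lambda>b. if b \<in> B then c b else 0) \<in> (\<Union>c'\<in>D. ?U c')"
      by (rule subsetD[OF D(3)])
    then obtain c' where "c' \<in> D" "(\<Sum>b\<in>B. \<bar>(if b \<in> B then c b else 0) - c' b\<bar>) < e"
      by (elim UN_E) simp
    then show "\<exists>c'\<in>D. (\<Sum>b\<in>B. \<bar>c b - c' b\<bar>) < e"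
      by (intro bexI[of _ c']) (simp_all cong: sum.cong)
  qed (use D in auto)
qed

section \<open>Seminorms of linear combinations as functions of the coefficients\<close>

context seminormed
begin

text \<open>Lipschitz dependence on the coefficients: it gives continuity on the coefficient sphere,
  and later the passage from a finite net to the whole sphere.\<close>

lemma coefficient_diff_le:
  assumes "\<And>b. b \<in> B \<Longrightarrow> f b \<in> S"
  shows "\<bar>N (\<Sum>b\<in>B. c b *\<^sub>R f b) - N (\<Sum>b\<in>B. c' b *\<^sub>R f b)\<bar> \<le> (\<Sum>b\<in>B. \<bar>c b - c' b\<bar> * N (f b))"
proof -
  have "\<bar>N (\<Sum>b\<in>B. c b *\<^sub>R f b) - N (\<Sum>b\<in>B. c' b *\<^sub>R f b)\<bar>
      \<le> N ((\<Sum>b\<in>B. c b *\<^sub>R f b) - (\<Sum>b\<in>B. c' b *\<^sub>R f b))"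
    using assms by (intro abs_diff sum_closed closed) auto
  also have "\<dots> = N (\<Sum>b\<in>B. (c b - c' b) *\<^sub>R f b)"
    by (simp add: scaleR_diff_left sum_subtractf)
  also have "\<dots> \<le> (\<Sum>b\<in>B. N ((c b - c' b) *\<^sub>R f b))"
    using assms by (intro sum_le closed) auto
  also have "\<dots> = (\<Sum>b\<in>B. \<bar>c b - c' b\<bar> * N (f b))"
    using assms by (intro sum.cong scale) auto
  finally show ?thesis .
qed

text \<open>Norm equivalence in finite dimension: the continuous function \<open>?f\<close> attains
  its minimum on the compact sphere, independence makes the minimum positive, and homogeneity
  carries it to all coefficients.\<close>

lemma coefficient_lower_bound:
  assumes "finite B" "B \<subseteq> S"
    and indep: "\<And>c. N (\<Sum>b\<in>B. c b *\<^sub>R b) = 0 \<Longrightarrow> \<forall>b\<in>B. c b = 0"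
  obtains m where "m > 0" "\<And>c. m * (\<Sum>b\<in>B. \<bar>c b\<bar>) \<le> N (\<Sum>b\<in>B. c b *\<^sub>R b)"
proof -
  let ?K = "{c :: 'a \<Rightarrow> real. (\<forall>b. b \<notin> B \<longrightarrow> c b = 0) \<and> (\<Sum>b\<in>B. \<bar>c b\<bar>) = 1}"
  let ?f = "\<lambda>c. N (\<Sum>b\<in>B. c b *\<^sub>R b)"
  have f_nonneg: "0 \<le> ?f c" for c
    using assms(2) by (intro nonneg sum_closed closed) auto
  have cont: "continuous_on ?K ?f"
    unfolding continuous_on_def
  proof
    fix c0 :: "'a \<Rightarrow> real"
    have coord: "((\<lambda>c. c b) \<longlongrightarrow> c0 b) (at c0 within ?K)" for b
    proof (rule tendsto_within_subset[OF _ subset_UNIV])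
      have "continuous_on UNIV (\<lambda>c :: 'a \<Rightarrow> real. c b)"
        by (rule continuous_on_product_coordinates)
      then show "((\<lambda>c. c b) \<longlongrightarrow> c0 b) (at c0)"
        by (simp add: continuous_on_def)
    qed
    have "((\<lambda>c. \<Sum>b\<in>B. \<bar>c b - c0 b\<bar> * N b) \<longlongrightarrow> (\<Sum>b\<in>B. \<bar>c0 b - c0 b\<bar> * N b)) (at c0 within ?K)"
      by (intro tendsto_intros coord)
    then have "((\<lambda>c. \<Sum>b\<in>B. \<bar>c b - c0 b\<bar> * N b) \<longlongrightarrow> 0) (at c0 within ?K)"
      by simp
    then have "((\<lambda>c. ?f c - ?f c0) \<longlongrightarrow> 0) (at c0 within ?K)"
      by (rule Lim_null_comparison[rotated])
        (use assms(2) in \<open>auto intro!: always_eventually coefficient_diff_le\<close>)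
    then show "(?f \<longlongrightarrow> ?f c0) (at c0 within ?K)"
      by (simp add: LIM_zero_iff)
  qed
  show ?thesis
  \<comment> \<open>The sphere is empty exactly when \<open>B\<close> is; every sum of coefficients
    is then 0 and any positive \<open>m\<close> works.\<close>
  proof (cases "?K = {}")
    case True
    have "(\<Sum>b\<in>B. \<bar>c b\<bar>) = 0" for c :: "'a \<Rightarrow> real"
    proof (rule ccontr)
      let ?s = "\<Sum>b\<in>B. \<bar>c b\<bar>"
      assume "?s \<noteq> 0"
      then have s: "?s > 0"
        by (metis abs_ge_zero order_le_less sum_nonneg)
      have "(\<lambda>b. if b \<in> B then c b / ?s else 0) \<in> ?K"
        using sum_abs_normalized[OF s] by simp
      then show False
        unfolding True by simp
    qed
    then show ?thesis
      using that[of 1] f_nonneg by simp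
  next
    case False
    obtain c0 where c0: "c0 \<in> ?K" "\<And>c. c \<in> ?K \<Longrightarrow> ?f c0 \<le> ?f c"
      using continuous_attains_inf[OF compact_coefficient_sphere[OF assms(1)] False cont] by blast
    show ?thesis
    proof
      have "?f c0 \<noteq> 0"
      proof
        assume "?f c0 = 0"
        from indep[OF this] have "(\<Sum>b\<in>B. \<bar>c0 b\<bar>) = 0"
          by simp
        with c0(1) show False
          by simp
      qed
      then show "?f c0 > 0"
        using f_nonneg[of c0] by linarith
    next
      fix c :: "'a \<Rightarrow> real"
      let ?s = "\<Sum>b\<in>B. \<bar>c b\<bar>"
      show "?f c0 * ?s \<le> ?f c"
      proof (cases "?s = 0")
        case True
        then show ?thesis
          using f_nonneg by simp
      next
        case False
        then have s: "?s > 0"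
          by (metis abs_ge_zero order_le_less sum_nonneg)
        let ?c = "\<lambda>b. if b \<in> B then c b / ?s else 0"
        have "?c \<in> ?K"
          using sum_abs_normalized[OF s] by simp
        then have "?f c0 \<le> ?f ?c"
          by (rule c0(2))
        also have "(\<Sum>b\<in>B. ?c b *\<^sub>R b) = (1 / ?s) *\<^sub>R (\<Sum>b\<in>B. c b *\<^sub>R b)"
          by (simp add: scaleR_sum_right cong: sum.cong)
        also have "N \<dots> = (1 / ?s) * ?f c"
          using scale[of "\<Sum>b\<in>B. c b *\<^sub>R b" "1 / ?s"] s assms(2) by (auto simp: sum_closed subset_iff)
        finally show ?thesis
          using s by (simp add: field_simps)
      qed
    qed
  qed
qed

section \<open>Finite-dimensional subspaces of the quotient\<close>

lemma submodule_image_span: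
  assumes "B \<subseteq> S"
  shows "submodule (cls ` span B) real_field Q"
proof (rule quotient.submoduleI)
  have sub: "span B \<subseteq> S"
    using assms subspace by (rule span_minimal)
  show "cls ` span B \<subseteq> carrier Q"
    using sub by auto
  show "\<zero>\<^bsub>Q\<^esub> \<in> cls ` span B"
    unfolding zero_quotient by (intro imageI span_zero)
  fix A assume "A \<in> cls ` span B"
  then obtain x where x: "x \<in> span B" "A = cls x"
    by blast
  have "\<ominus>\<^bsub>Q\<^esub> A = cls (- x)"
    by (rule quotient.minus_equality) (use x sub in \<open>auto simp: add_quotient zero_quotient\<close>)
  then show "\<ominus>\<^bsub>Q\<^esub> A \<in> cls ` span B"
    using x span_neg by blast
  show "a \<odot>\<^bsub>Q\<^esub> A \<in> cls ` span B" for a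
  proof -
    have "a \<odot>\<^bsub>Q\<^esub> A = cls (a *\<^sub>R x)"
      using x sub smult_quotient by blast
    then show ?thesis
      using span_scale[OF x(1)] by blast
  qed
  fix A' assume "A' \<in> cls ` span B"
  then obtain x' where x': "x' \<in> span B" "A' = cls x'"
    by blast
  have "A \<oplus>\<^bsub>Q\<^esub> A' = cls (x + x')"
    using x x' sub add_quotient by blast
  then show "A \<oplus>\<^bsub>Q\<^esub> A' \<in> cls ` span B"
    using span_add[OF x(1) x'(1)] by blast
qed

text \<open>Once the generators are lifted to \<open>B\<close>, hull and span agree: the image of
  \<open>span B\<close> is a submodule containing the generators, and the vectors whose class lies
  in \<open>F\<close> form a subspace containing \<open>B\<close>.\<close>

lemma finite_dim_subspace_span:
  assumes "finite_dim_subspace Q F"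
  obtains B where "finite B" "B \<subseteq> S" "F = cls ` span B"
proof -
  obtain B0 where B0: "finite B0" "F = (\<lambda>W. submodule W real_field Q) hull B0"
    and F: "submodule F real_field Q"
    using assms by (auto simp: finite_dim_subspace_def)
  note FE = quotient.submoduleE[OF F]
  have "B0 \<subseteq> F"
    unfolding B0(2) by (rule hull_subset)
  then have "B0 \<subseteq> cls ` S"
    using FE(1) by (simp add: carrier_quotient)
  then obtain B where B: "B \<subseteq> S" "finite B" "B0 = cls ` B"
    using B0(1) by (metis finite_subset_image)
  have "F \<subseteq> cls ` span B"
    unfolding B0(2)
  proof (rule hull_minimal)
    show "B0 \<subseteq> cls ` span B"
      unfolding B(3) by (intro image_mono span_superset)
  qed (rule submodule_image_span[OF B(1)])
  moreover have "cls ` span B \<subseteq> F"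
  proof -
    have "subspace {x \<in> S. cls x \<in> F}"
      unfolding subspace_def
    proof (intro conjI ballI allI)
      have "\<zero>\<^bsub>Q\<^esub> \<in> F"
        using subgroup.one_closed[OF submodule.axioms(1)[OF F]] by simp
      then show "0 \<in> {x \<in> S. cls x \<in> F}"
        by (simp add: zero_quotient)
    next
      fix x y assume "x \<in> {x \<in> S. cls x \<in> F}" "y \<in> {x \<in> S. cls x \<in> F}"
      then show "x + y \<in> {x \<in> S. cls x \<in> F}"
        using FE(5)[of "cls x" "cls y"] add_quotient[of x y] by simp
    next
      fix c x assume "x \<in> {x \<in> S. cls x \<in> F}"
      then show "c *\<^sub>R x \<in> {x \<in> S. cls x \<in> F}"
        using FE(4)[of c "cls x"] smult_quotient[of x c] by (simp add: ring_of_type_algebra_def)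
    qed
    then have "span B \<subseteq> {x \<in> S. cls x \<in> F}"
      using B \<open>B0 \<subseteq> F\<close> by (intro span_minimal) auto
    then show ?thesis
      by blast
  qed
  ultimately show ?thesis
    using that B by blast
qed

text \<open>A lift with the fewest elements is independent even modulo null vectors, since a
  nontrivial null combination would allow one element to be dropped. Independence in the ambient
  space alone would not exclude nonzero combinations of seminorm 0.\<close>

lemma finite_dim_subspace_basis:
  assumes "finite_dim_subspace Q F"
  obtains B where "finite B" "B \<subseteq> S" "F = cls ` span B"
    "\<And>c. N (\<Sum>b\<in>B. c b *\<^sub>R b) = 0 \<Longrightarrow> \<forall>b\<in>B. c b = 0"
proof -
  let ?P = "\<lambda>B. finite B \<and> B \<subseteq> S \<and> F = cls ` span B"
  have "\<exists>B. ?P B"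
    using finite_dim_subspace_span[OF assms] by metis
  then obtain B where B: "?P B" and least: "\<And>B'. ?P B' \<Longrightarrow> card B \<le> card B'"
    using ex_has_least_nat[of ?P _ card] by metis
  have spanS: "span B \<subseteq> S"
    using B subspace by (intro span_minimal) auto
  show ?thesis
  proof
    fix c assume null: "N (\<Sum>b\<in>B. c b *\<^sub>R b) = 0"
    show "\<forall>b\<in>B. c b = 0"
    proof (rule ccontr)
      assume "\<not> (\<forall>b\<in>B. c b = 0)"
      then obtain b0 where b0: "b0 \<in> B" "c b0 \<noteq> 0"
        by blast
      let ?z = "\<Sum>b\<in>B. c b *\<^sub>R b"
      have z: "?z \<in> S"
        using B by (intro sum_closed closed) auto
      have "cls ` span B \<subseteq> cls ` span (B - {b0})"
      proof
        fix A assume "A \<in> cls ` span B"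
        then obtain u where A: "A = cls (\<Sum>b\<in>B. u b *\<^sub>R b)"
          using B by (auto simp: span_finite)
        let ?x = "\<Sum>b\<in>B. u b *\<^sub>R b"
        \<comment> \<open>Subtracting \<open>?q *\<^sub>R ?z\<close> cancels the coefficient of
          \<open>b0\<close> and leaves the class unchanged, as \<open>?z\<close> is null.\<close>
        let ?q = "u b0 / c b0"
        have x: "?x \<in> S"
          using B by (intro sum_closed closed) auto
        have "?x - ?q *\<^sub>R ?z = (\<Sum>b\<in>B. (u b - ?q * c b) *\<^sub>R b)"
          by (simp add: scaleR_sum_right sum_subtractf scaleR_diff_left)
        also have "\<dots> = (\<Sum>b\<in>B - {b0}. (u b - ?q * c b) *\<^sub>R b)"
          using B b0 by (subst sum.remove[of B b0]) auto
        also have "\<dots> \<in> span (B - {b0})"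
          by (intro span_sum span_scale span_base)
        finally have "?x - ?q *\<^sub>R ?z \<in> span (B - {b0})" .
        moreover have "cls ?x = cls (?x - ?q *\<^sub>R ?z)"
          using x z null by (subst class_eq_iff) (auto simp: scale)
        ultimately show "A \<in> cls ` span (B - {b0})"
          unfolding A by blast
      qed
      moreover have "cls ` span (B - {b0}) \<subseteq> cls ` span B"
        by (intro image_mono span_mono) auto
      ultimately have "?P (B - {b0})"
        using B by auto
      with least[of "B - {b0}"] B b0 show False
        by (metis card_Diff1_less not_less)
    qed
  qed (use B in auto)
qed

text \<open>The error in \<open>approx\<close> is measured by the sum of the absolute coefficients.
  On an independent lift that sum is at most \<open>N x / m\<close>, so \<open>approx\<close> at
  \<open>\<delta> = \<eta> * m\<close> makes \<open>T\<close> isometric on \<open>span B\<close> up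
  to the relative error \<open>\<eta>\<close>.\<close>

lemma finitely_representableI:
  assumes approx: "\<And>B \<delta>. \<lbrakk>finite B; B \<subseteq> S; \<delta> > 0\<rbrakk> \<Longrightarrow> \<exists>T.
    (\<forall>x\<in>S. T x \<in> carrier Y) \<and> (\<forall>x\<in>S. \<forall>y\<in>S. T (x + y) = T x \<oplus>\<^bsub>Y\<^esub> T y) \<and>
    (\<forall>c. \<forall>x\<in>S. T (c *\<^sub>R x) = c \<odot>\<^bsub>Y\<^esub> T x) \<and>
    (\<forall>c. \<bar>vnorm Y (T (\<Sum>b\<in>B. c b *\<^sub>R b)) - N (\<Sum>b\<in>B. c b *\<^sub>R b)\<bar> \<le> \<delta> * (\<Sum>b\<in>B. \<bar>c b\<bar>))"
  shows "finitely_representable Q Y"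
  unfolding finitely_representable_def
proof (intro allI impI, elim conjE)
  fix F and e :: real assume F: "finite_dim_subspace Q F" and "e > 0"
  obtain B where B: "finite B" "B \<subseteq> S" "F = cls ` span B"
    and indep: "\<And>c. N (\<Sum>b\<in>B. c b *\<^sub>R b) = 0 \<Longrightarrow> \<forall>b\<in>B. c b = 0"
    by (rule finite_dim_subspace_basis[OF F]) (rule that)
  obtain m where m: "m > 0" "\<And>c. m * (\<Sum>b\<in>B. \<bar>c b\<bar>) \<le> N (\<Sum>b\<in>B. c b *\<^sub>R b)"
    by (rule coefficient_lower_bound[OF B(1,2)]) (erule indep, rule that)
  \<comment> \<open>The bound \<open>1 / 2\<close> serves injectivity and the inequality
    \<open>1 / (1 - \<eta>) \<le> 1 + 2 * \<eta>\<close> for the inverse; \<open>e / 4\<close> keeps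
    \<open>1 + 2 * \<eta>\<close> strictly below \<open>1 + e\<close>.\<close>
  define \<eta> where "\<eta> = min (1 / 2) (e / 4)"
  have \<eta>: "0 < \<eta>" "\<eta> \<le> 1 / 2" "\<eta> \<le> e / 4"
    using \<open>e > 0\<close> by (auto simp: \<eta>_def)
  have spanS: "span B \<subseteq> S"
    using B subspace by (intro span_minimal) auto
  obtain T where T: "\<And>x. x \<in> S \<Longrightarrow> T x \<in> carrier Y"
    "\<And>x y. \<lbrakk>x \<in> S; y \<in> S\<rbrakk> \<Longrightarrow> T (x + y) = T x \<oplus>\<^bsub>Y\<^esub> T y"
    "\<And>c x. x \<in> S \<Longrightarrow> T (c *\<^sub>R x) = c \<odot>\<^bsub>Y\<^esub> T x"
    "\<And>c. \<bar>vnorm Y (T (\<Sum>b\<in>B. c b *\<^sub>R b)) - N (\<Sum>b\<in>B. c b *\<^sub>R b)\<bar> \<le> (\<eta> * m) * (\<Sum>b\<in>B. \<bar>c b\<bar>)"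
  proof -
    have "\<eta> * m > 0"
      using \<eta> m by simp
    from approx[OF B(1,2) this] show ?thesis
      by (elim exE conjE) (rule that, blast, blast, drule spec, erule bspec, assumption, erule spec)
  qed
  have est: "\<bar>vnorm Y (T x) - N x\<bar> \<le> \<eta> * N x" if x: "x \<in> span B" for x
  proof -
    obtain c where c: "x = (\<Sum>b\<in>B. c b *\<^sub>R b)"
      using x unfolding span_finite[OF B(1)] by (rule imageE)
    have "\<bar>vnorm Y (T x) - N x\<bar> \<le> \<eta> * (m * (\<Sum>b\<in>B. \<bar>c b\<bar>))"
      using T(4)[of c] by (simp only: mult.assoc c)
    also have "\<dots> \<le> \<eta> * N x"
      unfolding c by (rule mult_left_mono[OF m(2)]) (use \<eta> in simp)
    finally show ?thesis .
  qed
  have inj: "inj_on cls (span B)"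
  proof (rule inj_onI)
    fix x y assume xy: "x \<in> span B" "y \<in> span B" "cls x = cls y"
    then obtain c where c: "x - y = (\<Sum>b\<in>B. c b *\<^sub>R b)"
      using span_diff[OF xy(1,2)] unfolding span_finite[OF B(1)] by (elim imageE)
    have "N (x - y) = 0"
      using xy spanS by (subst class_eq_iff[symmetric]) auto
    then have "\<forall>b\<in>B. c b = 0"
      unfolding c by (rule indep)
    then have "x - y = 0"
      unfolding c by simp
    then show "x = y"
      by simp
  qed
  \<comment> \<open>\<open>T\<close> need not respect classes on \<open>S\<close>, but each class in
    \<open>F\<close> has exactly one representative in \<open>span B\<close>, and evaluating there
    makes \<open>T\<close> descend.\<close>
  define R where "R A = T (inv_into (span B) cls A)" for A
  have R: "R (cls x) = T x" if "x \<in> span B" for x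
    using that inj by (simp add: R_def)
  have "linear_on F Q Y R"
    unfolding linear_on_def
  proof (intro conjI ballI allI)
    fix A assume "A \<in> F"
    then obtain x where x: "x \<in> span B" "A = cls x"
      using B(3) by blast
    then have xS: "x \<in> S"
      using spanS by blast
    show "R A \<in> carrier Y"
      using T(1)[OF xS] R x by simp
    show "R (c \<odot>\<^bsub>Q\<^esub> A) = c \<odot>\<^bsub>Y\<^esub> R A" for c
      using x xS R[of "c *\<^sub>R x"] by (simp add: R T(3) smult_quotient span_scale)
    fix A' assume "A' \<in> F"
    then obtain x' where x': "x' \<in> span B" "A' = cls x'"
      using B(3) by blast
    then have "x' \<in> S"
      using spanS by blast
    then show "R (A \<oplus>\<^bsub>Q\<^esub> A') = R A \<oplus>\<^bsub>Y\<^esub> R A'"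
      using x x' xS by (simp add: R T(2) add_quotient span_add)
  qed
  moreover have injR: "inj_on R F"
  proof (rule inj_onI)
    fix A A' assume "A \<in> F" "A' \<in> F" and eq: "R A = R A'"
    then obtain x x' where x: "x \<in> span B" "A = cls x" "x' \<in> span B" "A' = cls x'"
      using B(3) by blast
    have xS: "x \<in> S" "x' \<in> S"
      using x spanS by auto
    \<comment> \<open>No algebraic laws are assumed of \<open>Y\<close>, so \<open>T x\<close> and
      \<open>T x'\<close> cannot be subtracted there. Replacing one by the other leads to
      \<open>T 0\<close>, whose norm vanishes by \<open>est\<close> at 0.\<close>
    have "T (x - x') = T x \<oplus>\<^bsub>Y\<^esub> (-1) \<odot>\<^bsub>Y\<^esub> T x'"
      using T(2)[of x "(-1) *\<^sub>R x'"] T(3)[of x' "-1"] xS by (simp add: scaleR_minus1_left)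
    also have "\<dots> = T x' \<oplus>\<^bsub>Y\<^esub> (-1) \<odot>\<^bsub>Y\<^esub> T x'"
      using eq R x by simp
    also have "\<dots> = T 0"
      using T(2)[of x' "(-1) *\<^sub>R x'"] T(3)[of x' "-1"] xS by (simp add: scaleR_minus1_left)
    finally have "vnorm Y (T (x - x')) = 0"
      using est[OF span_zero] by simp
    then have "\<bar>N (x - x')\<bar> \<le> \<eta> * N (x - x')"
      using est[OF span_diff[OF x(1,3)]] by simp
    then have "N (x - x') \<le> 1 / 2 * N (x - x')"
      using mult_right_mono[OF \<eta>(2) nonneg[of "x - x'"]] xS by auto
    then show "A = A'"
      using nonneg[of "x - x'"] xS x class_eq_iff by auto
  qed
  moreover have "op_norm_on F Q Y R < ennreal (1 + e)"
  proof -
    have "op_norm_on F Q Y R \<le> ennreal (1 + \<eta>)"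
      unfolding op_norm_on_def
    proof (rule SUP_least)
      fix A assume "A \<in> {v \<in> F. vnorm Q v \<le> 1}"
      then obtain x where x: "x \<in> span B" "A = cls x" "vnorm Q A \<le> 1"
        using B(3) by blast
      then have "N x \<le> 1"
        using vnorm_quotient spanS by auto
      then have "\<eta> * N x \<le> \<eta> * 1"
        using \<eta>(1) by (intro mult_left_mono) auto
      then have "vnorm Y (R A) \<le> 1 + \<eta>"
        using est[OF x(1)] R[OF x(1)] x(2) \<open>N x \<le> 1\<close> by simp
      then show "ennreal (vnorm Y (R A)) \<le> ennreal (1 + \<eta>)"
        by (rule ennreal_leI)
    qed
    also have "\<dots> < ennreal (1 + e)"
      using \<eta> \<open>e > 0\<close> by (intro ennreal_lessI) auto
    finally show ?thesis .
  qed
  moreover have "op_norm_on (R ` F) Y Q (inv_into F R) < ennreal (1 + e)"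
  proof -
    have "op_norm_on (R ` F) Y Q (inv_into F R) \<le> ennreal (1 + 2 * \<eta>)"
      unfolding op_norm_on_def
    proof (rule SUP_least)
      fix v assume "v \<in> {v \<in> R ` F. vnorm Y v \<le> 1}"
      then obtain x where x: "x \<in> span B" "v = R (cls x)" "vnorm Y v \<le> 1"
        using B(3) by blast
      have F': "cls x \<in> F"
        using x B(3) by blast
      have "(1 - \<eta>) * N x \<le> 1"
        using est[OF x(1)] R[OF x(1)] x(2,3) by (simp add: left_diff_distrib)
      then have "N x \<le> 1 / (1 - \<eta>)"
        using \<eta> by (simp add: field_simps)
      also have "\<dots> \<le> 1 + 2 * \<eta>"
      proof -
        have "\<eta> * (2 * \<eta>) \<le> \<eta> * 1"
          using \<eta> by (intro mult_left_mono) auto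
        then have "1 \<le> (1 + 2 * \<eta>) * (1 - \<eta>)"
          by (simp add: algebra_simps)
        then show ?thesis
          using \<eta> by (subst pos_divide_le_eq) auto
      qed
      finally show "ennreal (vnorm Q (inv_into F R v)) \<le> ennreal (1 + 2 * \<eta>)"
        using injR F' x spanS vnorm_quotient[of x] by (auto intro!: ennreal_leI)
    qed
    also have "\<dots> < ennreal (1 + e)"
      using \<eta> \<open>e > 0\<close> by (intro ennreal_lessI) auto
    finally show ?thesis .
  qed
  ultimately show "\<exists>T. linear_on F Q Y T \<and> inj_on T F \<and> op_norm_on F Q Y T < ennreal (1 + e) \<and>
      op_norm_on (T ` F) Y Q (inv_into F T) < ennreal (1 + e)"
    by blast
qed

end

section \<open>Right uniformly continuous maps and means\<close>

definition vector_RUC :: "('g::topological_group_add \<Rightarrow> 'e::real_normed_vector) set" where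
  "vector_RUC = {f. bounded (range f) \<and>
     (\<forall>\<epsilon>>0. \<exists>U. open U \<and> 0 \<in> U \<and> (\<forall>x y. x - y \<in> U \<longrightarrow> norm (f x - f y) < \<epsilon>))}"

lemma RUC_b_eq: "RUC_b = vector_RUC"
  by (simp add: RUC_b_def vector_RUC_def right_uniformly_continuous_def)

lemma vector_RUC_bounded:
  assumes "f \<in> vector_RUC"
  obtains M where "M > 0" "\<And>x. norm (f x) \<le> M"
  using assms by (auto simp: vector_RUC_def bounded_pos)

lemma vector_RUC_uniform:
  assumes "f \<in> vector_RUC" "e > 0"
  obtains U where "open U" "0 \<in> U" "\<And>x y. x - y \<in> U \<Longrightarrow> norm (f x - f y) < e"
  using assms unfolding vector_RUC_def by blast

lemma vector_RUC_compose:
  fixes f :: "'g::topological_group_add \<Rightarrow> 'e::real_normed_vector"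
    and F :: "'e \<Rightarrow> 'd::real_normed_vector"
  assumes f: "f \<in> vector_RUC" and bdd: "bounded (F ` range f)"
    and unif: "uniformly_continuous_on (range f) F"
  shows "(\<lambda>x. F (f x)) \<in> vector_RUC"
proof -
  have "\<exists>U. open U \<and> 0 \<in> U \<and> (\<forall>x y. x - y \<in> U \<longrightarrow> norm (F (f x) - F (f y)) < e)" if "e > 0" for e
  proof -
    obtain d where d: "d > 0" "\<And>x y. dist (f x) (f y) < d \<Longrightarrow> dist (F (f x)) (F (f y)) < e"
      using uniformly_continuous_onE[OF unif \<open>e > 0\<close>] by (metis rangeI)
    obtain U where "open U" "0 \<in> U" "\<And>x y. x - y \<in> U \<Longrightarrow> norm (f x - f y) < d"
      using vector_RUC_uniform[OF f d(1)] by metis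
    then show ?thesis
      using d(2) by (intro exI[of _ U]) (auto simp: dist_norm)
  qed
  then show ?thesis
    using bdd by (simp add: vector_RUC_def image_image)
qed

lemma subspace_vector_RUC: "subspace (vector_RUC :: ('g::topological_group_add \<Rightarrow> 'e::real_normed_vector) set)"
  unfolding subspace_def
proof (intro conjI ballI allI)
  show "(0 :: 'g \<Rightarrow> 'e) \<in> vector_RUC"
    by (auto simp: vector_RUC_def zero_fun_def intro!: exI[of _ UNIV])
next
  fix f g :: "'g \<Rightarrow> 'e" assume fg: "f \<in> vector_RUC" "g \<in> vector_RUC"
  obtain M M' where "\<And>x. norm (f x) \<le> M" "\<And>x. norm (g x) \<le> M'"
    using vector_RUC_bounded[OF fg(1)] vector_RUC_bounded[OF fg(2)] by metis
  then have "norm ((f + g) x) \<le> M + M'" for x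
    by (simp add: norm_triangle_mono)
  then have "bounded (range (f + g))"
    unfolding bounded_iff by blast
  moreover have "\<exists>U. open U \<and> 0 \<in> U \<and> (\<forall>x y. x - y \<in> U \<longrightarrow> norm ((f + g) x - (f + g) y) < e)"
    if "e > 0" for e
  proof -
    have "e / 2 > 0"
      using that by simp
    then obtain U U' where U: "open U" "0 \<in> U" "\<And>x y. x - y \<in> U \<Longrightarrow> norm (f x - f y) < e / 2"
      "open U'" "0 \<in> U'" "\<And>x y. x - y \<in> U' \<Longrightarrow> norm (g x - g y) < e / 2"
      using vector_RUC_uniform[OF fg(1)] vector_RUC_uniform[OF fg(2)] by metis
    have "norm ((f + g) x - (f + g) y) < e" if "x - y \<in> U \<inter> U'" for x y
      using norm_triangle_ineq[of "f x - f y" "g x - g y"] U(3)[of x y] U(6)[of x y] that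
      by (simp add: algebra_simps)
    then show ?thesis
      using U by (intro exI[of _ "U \<inter> U'"]) auto
  qed
  ultimately show "f + g \<in> vector_RUC"
    by (simp add: vector_RUC_def)
next
  fix c :: real and f :: "'g \<Rightarrow> 'e" assume f: "f \<in> vector_RUC"
  then have "bounded ((\<lambda>v. c *\<^sub>R v) ` range f)"
    by (intro bounded_scaling) (simp add: vector_RUC_def)
  moreover have "uniformly_continuous_on (range f) (\<lambda>v. c *\<^sub>R v)"
    by (intro bounded_linear.uniformly_continuous_on[OF bounded_linear_scaleR_right]
        uniformly_continuous_on_id)
  ultimately show "c *\<^sub>R f \<in> vector_RUC"
    using vector_RUC_compose[OF f, of "\<lambda>v. c *\<^sub>R v"] by (simp add: scaleR_fun_def)
qed

lemma RUC_b_const [simp, intro]: "(\<lambda>_. c) \<in> RUC_b"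
  by (auto simp: RUC_b_eq vector_RUC_def intro!: exI[of _ UNIV])

lemma RUC_b_add [intro]: "\<lbrakk>f \<in> RUC_b; g \<in> RUC_b\<rbrakk> \<Longrightarrow> (\<lambda>x. f x + g x) \<in> RUC_b"
  using subspace_add[OF subspace_vector_RUC, of f g] by (simp add: RUC_b_eq plus_fun_def)

lemma RUC_b_scale [intro]: "f \<in> RUC_b \<Longrightarrow> (\<lambda>x. c * f x) \<in> RUC_b"
  using subspace_mul[OF subspace_vector_RUC, of f c] by (simp add: RUC_b_eq scaleR_fun_def)

lemma RUC_b_diff [intro]: "\<lbrakk>f \<in> RUC_b; g \<in> RUC_b\<rbrakk> \<Longrightarrow> (\<lambda>x. f x - g x) \<in> RUC_b"
  using subspace_diff[OF subspace_vector_RUC, of f g] by (simp add: RUC_b_eq fun_diff_def)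

lemma RUC_b_sum [intro]:
  "(\<And>i. i \<in> I \<Longrightarrow> f i \<in> RUC_b) \<Longrightarrow> (\<lambda>x. \<Sum>i\<in>I. f i x) \<in> RUC_b"
  by (induction I rule: infinite_finite_induct) auto

text \<open>For \<open>p > 1\<close> the power is not uniformly continuous on the half-line, but a
  bounded map takes its norms in a compact interval \<open>{0..M}\<close>, where it is.\<close>

lemma vector_RUC_norm_powr:
  fixes f :: "'g::topological_group_add \<Rightarrow> 'e::real_normed_vector"
  assumes f: "f \<in> vector_RUC" and p: "p \<ge> 1"
  shows "(\<lambda>x. norm (f x) powr p) \<in> RUC_b"
proof -
  obtain M where M: "\<And>x. norm (f x) \<le> M"
    using vector_RUC_bounded[OF f] by metis
  have "uniformly_continuous_on (range f) norm"
    by (intro uniformly_continuous_on_norm uniformly_continuous_on_id)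
  moreover have "bounded (norm ` range f)"
    using M by (auto simp: bounded_iff)
  ultimately have nf: "(\<lambda>x. norm (f x)) \<in> vector_RUC"
    using vector_RUC_compose[OF f] by blast
  have ran: "range (\<lambda>x. norm (f x)) \<subseteq> {0..M}"
    using M by auto
  have cont: "continuous_on {0..M} (\<lambda>t. t powr p)"
    using p by (intro continuous_on_powr') auto
  have "uniformly_continuous_on (range (\<lambda>x. norm (f x))) (\<lambda>t. t powr p)"
    using compact_uniformly_continuous[OF cont] ran
    unfolding uniformly_continuous_on_def by (meson compact_Icc subsetD)
  moreover have "bounded ((\<lambda>t. t powr p) ` range (\<lambda>x. norm (f x)))"
    by (rule bounded_subset[OF compact_imp_bounded[OF compact_continuous_image[OF cont]] image_mono[OF ran]]) simp
  ultimately show ?thesis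
    using vector_RUC_compose[OF nf] by (simp add: RUC_b_eq)
qed

section \<open>Two inequalities for real powers\<close>

lemma powr_convex_nonneg:
  fixes p :: real
  assumes "p \<ge> 1" "s \<ge> 0" "t \<ge> 0" "s + t = 1" "u \<ge> 0" "v \<ge> 0"
  shows "(s * u + t * v) powr p \<le> s * u powr p + t * v powr p"
proof -
  \<comment> \<open>Convexity proper is invoked at positive \<open>u\<close> and \<open>v\<close>
    only; when one of them is 0, the claim is this estimate, which rests on
    \<open>r powr p \<le> r\<close>.\<close>
  have shrink: "(r * w) powr p \<le> r * w powr p" if "0 \<le> r" "r \<le> 1" for r w :: real
    using that assms(1) powr_mono'[of 1 p r] by (auto simp: powr_mult intro!: mult_right_mono)
  consider "u = 0" | "v = 0" | "u > 0" "v > 0"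
    using assms by linarith
  then show ?thesis
  proof cases
    case 3
    have "s = 1 - t" "t \<le> 1"
      using assms by auto
    with 3 show ?thesis
      using convex_onD[OF powr_convex[OF assms(1)], of t u v] assms(3) by simp
  qed (use shrink assms in auto)
qed

text \<open>Superadditivity of the power: \<open>(a - b) / a\<close> and \<open>b / a\<close> add up
  to 1, and \<open>r powr p \<le> r\<close> on the unit interval. It later turns closeness of p-th
  powers of seminorms into closeness of the seminorms.\<close>

lemma powr_diff_le:
  fixes a b p :: real
  assumes "p \<ge> 1" "a \<ge> 0" "b \<ge> 0"
  shows "\<bar>a - b\<bar> powr p \<le> \<bar>a powr p - b powr p\<bar>"
proof -
  have *: "(a - b) powr p \<le> a powr p - b powr p" if "0 \<le> b" "b \<le> a" for a b :: real
  proof (cases "a = 0")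
    case False
    with that have a: "a > 0"
      by simp
    have shrink: "r powr p \<le> r" if "0 \<le> r" "r \<le> 1" for r :: real
      using that assms(1) powr_mono'[of 1 p r] by simp
    have "((a - b) / a) powr p + (b / a) powr p \<le> (a - b) / a + b / a"
      using that a by (intro add_mono shrink) auto
    also have "\<dots> = 1"
      using a by (simp add: field_simps)
    finally have "((a - b) powr p + b powr p) / a powr p \<le> 1"
      using a that by (simp add: powr_divide add_divide_distrib)
    then show ?thesis
      using a by (simp add: field_simps)
  qed (use that in auto)
  have mono: "b powr p \<le> a powr p" if "0 \<le> b" "b \<le> a" for a b :: real
    using that assms(1) by (intro powr_mono2) auto
  show ?thesis
    using *[of b a] *[of a b] mono[of b a] mono[of a b] assms by (cases "a \<le> b") auto
qed

text \<open>Invariance is kept apart so that weighted means of evaluations, which need not be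
  invariant, are instances as well and inherit the seminorm properties.\<close>

locale mean =
  fixes \<mu> :: "('g::topological_group_add \<Rightarrow> real) \<Rightarrow> real"
  assumes add: "\<lbrakk>f \<in> RUC_b; h \<in> RUC_b\<rbrakk> \<Longrightarrow> \<mu> (\<lambda>x. f x + h x) = \<mu> f + \<mu> h"
    and scale: "f \<in> RUC_b \<Longrightarrow> \<mu> (\<lambda>x. c * f x) = c * \<mu> f"
    and nonneg: "\<lbrakk>f \<in> RUC_b; \<And>x. 0 \<le> f x\<rbrakk> \<Longrightarrow> 0 \<le> \<mu> f"
    and one: "\<mu> (\<lambda>_. 1) = 1"
begin

lemma const: "\<mu> (\<lambda>_. c) = c"
  using scale[of "\<lambda>_. 1" c] one by simp

lemma diff: "\<lbrakk>f \<in> RUC_b; h \<in> RUC_b\<rbrakk> \<Longrightarrow> \<mu> (\<lambda>x. f x - h x) = \<mu> f - \<mu> h"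
  using add[OF RUC_b_diff, of f h h] by simp

lemma mono: "\<lbrakk>f \<in> RUC_b; h \<in> RUC_b; \<And>x. f x \<le> h x\<rbrakk> \<Longrightarrow> \<mu> f \<le> \<mu> h"
  using nonneg[OF RUC_b_diff, of h f] diff[of h f] by simp

lemma sum: "(\<And>i. i \<in> I \<Longrightarrow> f i \<in> RUC_b) \<Longrightarrow> \<mu> (\<lambda>x. \<Sum>i\<in>I. f i x) = (\<Sum>i\<in>I. \<mu> (f i))"
proof (induction I rule: infinite_finite_induct)
  case (insert i I)
  then show ?case
    using add[of "f i" "\<lambda>x. \<Sum>i\<in>I. f i x"] by (simp add: RUC_b_sum)
qed (auto simp: const)

end

section \<open>The seminorm attached to a mean\<close>

definition Lp_mean :: "(('g \<Rightarrow> real) \<Rightarrow> real) \<Rightarrow> real \<Rightarrow> ('g \<Rightarrow> 'e::real_normed_vector) \<Rightarrow> real" where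
  "Lp_mean \<mu> p f = \<mu> (\<lambda>x. norm (f x) powr p) powr (1 / p)"

context mean
begin

lemma Lp_mean_nonneg: "0 \<le> Lp_mean \<mu> p f"
  by (simp add: Lp_mean_def)

lemma Lp_mean_powr:
  assumes "f \<in> vector_RUC" "p \<ge> 1"
  shows "Lp_mean \<mu> p f powr p = \<mu> (\<lambda>x. norm (f x) powr p)"
  using nonneg[OF vector_RUC_norm_powr[OF assms]] assms(2) by (simp add: Lp_mean_def powr_powr)

lemma Lp_mean_le_iff:
  assumes "f \<in> vector_RUC" "p \<ge> 1" "a \<ge> 0"
  shows "Lp_mean \<mu> p f \<le> a \<longleftrightarrow> \<mu> (\<lambda>x. norm (f x) powr p) \<le> a powr p"
  unfolding Lp_mean_powr[OF assms(1,2), symmetric] using assms Lp_mean_nonneg[of p f]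
  by (metis linorder_not_less order_less_imp_le powr_less_mono2 powr_mono2 zero_less_one
      order.strict_trans1 less_le_trans)

lemma Lp_mean_le:
  assumes "f \<in> vector_RUC" "p \<ge> 1" "a \<ge> 0" "\<And>x. norm (f x) \<le> a"
  shows "Lp_mean \<mu> p f \<le> a"
  unfolding Lp_mean_le_iff[OF assms(1-3)]
  using mono[OF vector_RUC_norm_powr[OF assms(1,2)], of "\<lambda>_. a powr p"] assms
  by (simp add: const powr_mono2)

lemma Lp_mean_ge:
  assumes "f \<in> vector_RUC" "p \<ge> 1" "a \<ge> 0" "\<And>x. a \<le> norm (f x)"
  shows "a \<le> Lp_mean \<mu> p f"
proof -
  have "a powr p \<le> \<mu> (\<lambda>x. norm (f x) powr p)"
    using mono[OF _ vector_RUC_norm_powr[OF assms(1,2)], of "\<lambda>_. a powr p"] assms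
    by (simp add: const powr_mono2)
  then have "(a powr p) powr (1 / p) \<le> Lp_mean \<mu> p f"
    unfolding Lp_mean_def using assms(2) by (intro powr_mono2) auto
  then show ?thesis
    using assms by (simp add: powr_powr)
qed

text \<open>Minkowski's inequality from convexity alone: divide \<open>f\<close> and
  \<open>g\<close> by numbers \<open>a\<close> and \<open>b\<close> strictly above their seminorms,
  apply convexity pointwise with weights \<open>a / (a + b)\<close> and \<open>b / (a + b)\<close>,
  and take the mean. Strictness keeps the divisors positive; \<open>a\<close> and \<open>b\<close>
  finally exceed the seminorms by \<open>e / 2\<close> each.\<close>

lemma seminormed_Lp_mean:
  assumes p: "p \<ge> 1"
  shows "seminormed (vector_RUC :: ('g \<Rightarrow> 'e::real_normed_vector) set) (Lp_mean \<mu> p)"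
proof
  show "subspace (vector_RUC :: ('g \<Rightarrow> 'e) set)"
    by (rule subspace_vector_RUC)
next
  fix f :: "'g \<Rightarrow> 'e" and c assume f: "f \<in> vector_RUC"
  have "\<mu> (\<lambda>x. norm ((c *\<^sub>R f) x) powr p) = \<bar>c\<bar> powr p * \<mu> (\<lambda>x. norm (f x) powr p)"
    using scale[OF vector_RUC_norm_powr[OF f p]] by (simp add: powr_mult)
  then show "Lp_mean \<mu> p (c *\<^sub>R f) = \<bar>c\<bar> * Lp_mean \<mu> p f"
    using p by (simp add: Lp_mean_def powr_mult powr_powr)
next
  fix f g :: "'g \<Rightarrow> 'e" assume fg: "f \<in> vector_RUC" "g \<in> vector_RUC"
  note norms = vector_RUC_norm_powr[OF fg(1) p] vector_RUC_norm_powr[OF fg(2) p]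
  have *: "Lp_mean \<mu> p (f + g) \<le> a + b" if ab: "Lp_mean \<mu> p f < a" "Lp_mean \<mu> p g < b" for a b
  proof -
    have pos: "a > 0" "b > 0"
      using ab Lp_mean_nonneg[of p f] Lp_mean_nonneg[of p g] by linarith+
    let ?s = "a / (a + b)" and ?t = "b / (a + b)"
    let ?A = "\<lambda>x. (?s * (a + b) powr p / a powr p) * norm (f x) powr p"
    let ?B = "\<lambda>x. (?t * (a + b) powr p / b powr p) * norm (g x) powr p"
    have "norm ((f + g) x) powr p \<le> ?A x + ?B x" for x
    proof -
      have "norm ((f + g) x) powr p \<le> ((a + b) * (?s * (norm (f x) / a) + ?t * (norm (g x) / b))) powr p"
      proof (intro powr_mono2)
        have "(a + b) * (?s * (norm (f x) / a) + ?t * (norm (g x) / b)) = norm (f x) + norm (g x)"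
          using pos by (simp add: distrib_left)
        then show "norm ((f + g) x) \<le> (a + b) * (?s * (norm (f x) / a) + ?t * (norm (g x) / b))"
          using norm_triangle_ineq[of "f x" "g x"] by simp
      qed (use p in auto)
      also have "\<dots> = (a + b) powr p * (?s * (norm (f x) / a) + ?t * (norm (g x) / b)) powr p"
        by (rule powr_mult)
      also have "\<dots> \<le> (a + b) powr p * (?s * (norm (f x) / a) powr p + ?t * (norm (g x) / b) powr p)"
        using p pos by (intro mult_left_mono powr_convex_nonneg) (auto simp flip: add_divide_distrib)
      also have "\<dots> = ?A x + ?B x"
        by (simp add: powr_divide algebra_simps)
      finally show ?thesis .
    qed
    then have "\<mu> (\<lambda>x. norm ((f + g) x) powr p) \<le> \<mu> (\<lambda>x. ?A x + ?B x)"
      by (rule mono[OF vector_RUC_norm_powr[OF subspace_add[OF subspace_vector_RUC fg] p]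
            RUC_b_add[OF RUC_b_scale[OF norms(1)] RUC_b_scale[OF norms(2)]]])
    also have "\<dots> = (?s * (a + b) powr p / a powr p) * \<mu> (\<lambda>x. norm (f x) powr p)
        + (?t * (a + b) powr p / b powr p) * \<mu> (\<lambda>x. norm (g x) powr p)"
      by (subst add[OF RUC_b_scale[OF norms(1)] RUC_b_scale[OF norms(2)]])
        (simp only: scale[OF norms(1)] scale[OF norms(2)])
    also have "\<dots> \<le> (?s * (a + b) powr p / a powr p) * a powr p + (?t * (a + b) powr p / b powr p) * b powr p"
      using ab pos Lp_mean_le_iff[OF fg(1) p, of a] Lp_mean_le_iff[OF fg(2) p, of b]
      by (intro add_mono mult_left_mono) auto
    also have "\<dots> = (?s + ?t) * (a + b) powr p"
    proof -
      have "r / c powr p * c powr p = r" if "c > 0" for r c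
        using that by simp
      then show ?thesis
        using pos by (simp only: distrib_right)
    qed
    also have "\<dots> = (a + b) powr p"
      using pos by (simp flip: add_divide_distrib)
    finally show ?thesis
      using Lp_mean_le_iff[OF subspace_add[OF subspace_vector_RUC fg] p, of "a + b"] pos by simp
  qed
  show "Lp_mean \<mu> p (f + g) \<le> Lp_mean \<mu> p f + Lp_mean \<mu> p g"
  proof (rule field_le_epsilon)
    fix e :: real assume "e > 0"
    then show "Lp_mean \<mu> p (f + g) \<le> Lp_mean \<mu> p f + Lp_mean \<mu> p g + e"
      using *[of "Lp_mean \<mu> p f + e / 2" "Lp_mean \<mu> p g + e / 2"] by simp
  qed
qed

end

section \<open>Approximation of means by finite convex combinations of evaluations\<close>

definition convex_weights :: "('a \<Rightarrow> real) \<Rightarrow> bool" where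
  "convex_weights w \<longleftrightarrow> finite {x. w x \<noteq> 0} \<and> (\<forall>x. 0 \<le> w x) \<and> (\<Sum>x | w x \<noteq> 0. w x) = 1"

definition weighted_mean :: "('a \<Rightarrow> real) \<Rightarrow> ('a \<Rightarrow> real) \<Rightarrow> real" where
  "weighted_mean w f = (\<Sum>x | w x \<noteq> 0. w x * f x)"

lemma weighted_mean_superset:
  assumes "finite A" "{x. w x \<noteq> 0} \<subseteq> A"
  shows "weighted_mean w f = (\<Sum>x\<in>A. w x * f x)"
  unfolding weighted_mean_def using assms by (intro sum.mono_neutral_left) auto

lemma weighted_mean_one: "convex_weights w \<Longrightarrow> weighted_mean w (\<lambda>_. 1) = 1"
  by (simp add: weighted_mean_def convex_weights_def)

lemma mean_weighted_mean:
  assumes "convex_weights w"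
  shows "mean (weighted_mean w)"
proof
  show "weighted_mean w (\<lambda>x. f x + h x) = weighted_mean w f + weighted_mean w h" for f h
    by (simp add: weighted_mean_def distrib_left sum.distrib)
  show "weighted_mean w (\<lambda>x. c * f x) = c * weighted_mean w f" for c f
    by (simp add: weighted_mean_def sum_distrib_left mult.left_commute)
  show "0 \<le> weighted_mean w f" if "\<And>x. 0 \<le> f x" for f
    using that assms by (auto simp: weighted_mean_def convex_weights_def intro!: sum_nonneg)
  show "weighted_mean w (\<lambda>_. 1) = 1"
    by (rule weighted_mean_one[OF assms])
qed

text \<open>The segment from \<open>w\<close> to the point mass at \<open>x\<close>, along which
  \<open>convex_approximation\<close> descends.\<close>

lemma convex_weights_mix:
  fixes x :: 'a and t :: real
  assumes w: "convex_weights w" and t: "0 \<le> t" "t \<le> 1"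
  defines "w' \<equiv> \<lambda>y. (1 - t) * w y + (if y = x then t else 0)"
  shows "convex_weights w'" "weighted_mean w' f = (1 - t) * weighted_mean w f + t * f x"
proof -
  let ?A = "insert x {y. w y \<noteq> 0}"
  have fin: "finite ?A"
    using w by (simp add: convex_weights_def)
  have sub: "{y. w' y \<noteq> 0} \<subseteq> ?A"
    by (auto simp: w'_def)
  show mix: "weighted_mean w' f = (1 - t) * weighted_mean w f + t * f x" for f
  proof -
    have "weighted_mean w' f = (\<Sum>y\<in>?A. (1 - t) * (w y * f y) + (if y = x then t * f y else 0))"
      unfolding weighted_mean_superset[OF fin sub] by (intro sum.cong) (auto simp: w'_def algebra_simps)
    also have "\<dots> = (1 - t) * (\<Sum>y\<in>?A. w y * f y) + t * f x"
      using fin by (simp add: sum.distrib sum_distrib_left)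
    also have "(\<Sum>y\<in>?A. w y * f y) = weighted_mean w f"
      by (rule weighted_mean_superset[symmetric, OF fin]) auto
    finally show ?thesis .
  qed
  have "weighted_mean w' (\<lambda>_. 1) = 1"
    by (simp add: mix weighted_mean_one[OF w])
  then show "convex_weights w'"
    using w t finite_subset[OF sub fin] by (auto simp: convex_weights_def weighted_mean_def w'_def)
qed

lemma convex_weights_point: "convex_weights (\<lambda>y. if y = x then 1 else 0)"
  by (simp add: convex_weights_def)

text \<open>Instead of separating \<open>(\<mu> (f i))\<close> from the convex hull of the points \<open>(f i x)\<close>, minimise the
  squared distance: since \<open>\<mu>\<close> is monotone, some evaluation does not point away from \<open>(\<mu> (f i))\<close>,
  and moving a small step towards it would decrease a positive infimum.\<close>

lemma (in mean) convex_approximation: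
  fixes f :: "'i \<Rightarrow> 'g \<Rightarrow> real"
  assumes I: "finite I" and f: "\<And>i. i \<in> I \<Longrightarrow> f i \<in> RUC_b" and "e > 0"
  obtains w where "convex_weights w" "\<And>i. i \<in> I \<Longrightarrow> \<bar>weighted_mean w (f i) - \<mu> (f i)\<bar> < e"
proof -
  define dev where "dev w i = weighted_mean w (f i) - \<mu> (f i)" for w i
  define D where "D w = (\<Sum>i\<in>I. (dev w i)\<^sup>2)" for w
  have "\<exists>w. convex_weights w \<and> D w < e\<^sup>2"
  proof (rule ccontr)
    assume far: "\<not> ?thesis"
    let ?X = "D ` Collect convex_weights"
    define m where "m = Inf ?X"
    have D_nonneg: "0 \<le> D w" for w
      unfolding D_def by (intro sum_nonneg) auto
    have bdd: "bdd_below ?X"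
      using D_nonneg by (intro bdd_belowI[of _ 0]) auto
    have ne: "?X \<noteq> {}"
      using convex_weights_point[of undefined] by (metis empty_iff image_eqI mem_Collect_eq)
    have "e\<^sup>2 \<le> m"
      unfolding m_def using far by (intro cInf_greatest[OF ne]) force
    then have m: "m > 0"
      using \<open>e > 0\<close> by (meson less_le_trans zero_less_power)
    have m_le: "m \<le> D w" if "convex_weights w" for w
      unfolding m_def using that bdd by (intro cInf_lower) auto
    have "\<exists>M. \<forall>x. (f i x - \<mu> (f i))\<^sup>2 \<le> M" if "i \<in> I" for i
    proof -
      have "(\<lambda>x. f i x - \<mu> (f i)) \<in> vector_RUC"
        using RUC_b_diff[OF f[OF that] RUC_b_const] by (simp add: RUC_b_eq)
      then obtain M where "\<And>x. norm (f i x - \<mu> (f i)) \<le> M"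
        using vector_RUC_bounded by metis
      then have "(f i x - \<mu> (f i))\<^sup>2 \<le> M\<^sup>2" for x
        by (simp add: abs_le_square_iff[symmetric] order_trans[OF _ abs_ge_self])
      then show ?thesis
        by blast
    qed
    then obtain M where M: "\<And>i x. i \<in> I \<Longrightarrow> (f i x - \<mu> (f i))\<^sup>2 \<le> M i"
      by metis
    define K where "K = (\<Sum>i\<in>I. M i)"
    have K: "(\<Sum>i\<in>I. (f i x - \<mu> (f i))\<^sup>2) \<le> K" for x
      unfolding K_def by (intro sum_mono M)
    have "0 \<le> K"
      using K[of undefined] by (meson order_trans sum_nonneg zero_le_power2)
    \<comment> \<open>This \<open>t\<close> minimises
      \<open>(1 - t)\<^sup>2 * m + t\<^sup>2 * K\<close>; the minimum is
      \<open>m - t * m\<close>.\<close>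
    define t where "t = m / (m + K)"
    have t: "0 < t" "t \<le> 1" "t * (m + K) = m"
      using m \<open>0 \<le> K\<close> by (auto simp: t_def)
    \<comment> \<open>Slack for the near-minimal \<open>w\<close> and for the choice of
      \<open>x\<close>. Together they cost at most \<open>h\<close>, and the gain is
      \<open>t * m\<close>, so any smaller positive number would do.\<close>
    define h where "h = t * m / 6"
    have h: "h > 0"
      using t m by (simp add: h_def)
    then obtain w where w: "convex_weights w" "D w < m + h"
      using cInf_lessD[OF ne, of "m + h"] by (auto simp: m_def)
    \<comment> \<open>As a function of \<open>x\<close> the sum has mean 0, so it cannot be at least
      \<open>h\<close> everywhere.\<close>
    have "\<exists>x. (\<Sum>i\<in>I. dev w i * (f i x - \<mu> (f i))) < h"
    proof (rule ccontr)
      assume "\<not> ?thesis"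
      then have "\<mu> (\<lambda>_. h) \<le> \<mu> (\<lambda>x. \<Sum>i\<in>I. dev w i * (f i x - \<mu> (f i)))"
        using f by (intro mono) (auto simp: not_less intro!: RUC_b_sum RUC_b_scale RUC_b_diff)
      also have "\<dots> = (\<Sum>i\<in>I. \<mu> (\<lambda>x. dev w i * (f i x - \<mu> (f i))))"
        using f by (intro sum RUC_b_scale RUC_b_diff RUC_b_const)
      also have "\<dots> = 0"
        using f by (intro sum.neutral) (auto simp: scale diff const RUC_b_diff)
      finally show False
        using h by (simp add: const)
    qed
    then obtain x where x: "(\<Sum>i\<in>I. dev w i * (f i x - \<mu> (f i))) < h"
      by blast
    define w' where "w' = (\<lambda>y. (1 - t) * w y + (if y = x then t else 0))"
    have w': "convex_weights w'" "\<And>f. weighted_mean w' f = (1 - t) * weighted_mean w f + t * f x"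
      unfolding w'_def using convex_weights_mix[OF w(1)] t by auto
    have dev': "dev w' i = (1 - t) * dev w i + t * (f i x - \<mu> (f i))" for i
      by (simp add: dev_def w'(2) algebra_simps)
    have "D w' = (\<Sum>i\<in>I. (1 - t)\<^sup>2 * (dev w i)\<^sup>2
        + 2 * t * (1 - t) * (dev w i * (f i x - \<mu> (f i))) + t\<^sup>2 * (f i x - \<mu> (f i))\<^sup>2)"
      unfolding D_def dev' by (intro sum.cong refl) (simp add: power2_eq_square algebra_simps)
    also have "\<dots> = (1 - t)\<^sup>2 * D w + 2 * t * (1 - t) * (\<Sum>i\<in>I. dev w i * (f i x - \<mu> (f i)))
        + t\<^sup>2 * (\<Sum>i\<in>I. (f i x - \<mu> (f i))\<^sup>2)"
      by (simp add: D_def sum.distrib sum_distrib_left)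
    also have "\<dots> \<le> (1 - t)\<^sup>2 * (m + h) + 2 * t * (1 - t) * h + t\<^sup>2 * K"
      using w(2) x K t by (intro add_mono mult_left_mono) auto
    also have "\<dots> = (1 - t)\<^sup>2 * m + t\<^sup>2 * K + (1 - t\<^sup>2) * h"
      by (simp add: power2_eq_square algebra_simps)
    also have "\<dots> \<le> (1 - t)\<^sup>2 * m + t\<^sup>2 * K + h"
      using h t by (simp add: algebra_simps)
    also have "\<dots> = m - 2 * t * m + t * (t * (m + K)) + h"
      by (simp add: power2_eq_square algebra_simps)
    also have "\<dots> = m - t * m + h"
      using t(3) by simp
    also have "\<dots> < m"
      using t m by (simp add: h_def)
    finally show False
      using m_le[OF w'(1)] by simp
  qed
  then obtain w where w: "convex_weights w" "D w < e\<^sup>2"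
    by blast
  show ?thesis
  proof
    fix i assume "i \<in> I"
    then have "(dev w i)\<^sup>2 \<le> D w"
      unfolding D_def using I by (intro member_le_sum) auto
    then have "\<bar>dev w i\<bar>\<^sup>2 < e\<^sup>2"
      using w(2) by simp
    then show "\<bar>weighted_mean w (f i) - \<mu> (f i)\<bar> < e"
      unfolding dev_def by (rule power2_less_imp_less) (use \<open>e > 0\<close> in simp)
  qed (rule w(1))
qed

section \<open>Step functions in the Bochner space\<close>

lemma Lp_class_self: "f \<in> Lp_functions p \<Longrightarrow> f \<in> Lp_class p f"
  by (simp add: Lp_class_def)

lemma Lp_class_cong:
  assumes "AE t in lebesgue_on {0..1}. f t = g t"
  shows "Lp_class p f = Lp_class p g"
proof -
  have "(AE t in lebesgue_on {0..1}. h t = f t) \<longleftrightarrow> (AE t in lebesgue_on {0..1}. h t = g t)" for h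
    using assms by (intro iffI; elim AE_mp) (auto elim!: AE_mp intro!: AE_I2)
  then show ?thesis
    by (simp add: Lp_class_def)
qed

lemma Lp_classD: "g \<in> Lp_class p f \<Longrightarrow> AE t in lebesgue_on {0..1}. g t = f t"
  by (simp add: Lp_class_def)

lemma carrier_Lp: "f \<in> Lp_functions p \<Longrightarrow> Lp_class p f \<in> carrier (Lp p)"
  by (simp add: Lp_def)

text \<open>Sums of representatives agree almost everywhere and classes are nonempty, so the union
  defining \<open>add\<close> runs over copies of one and the same class.\<close>

lemma add_Lp:
  assumes "f \<in> Lp_functions p" "g \<in> Lp_functions p"
  shows "Lp_class p f \<oplus>\<^bsub>Lp p\<^esub> Lp_class p g = Lp_class p (\<lambda>t. f t + g t)"
proof -
  have "Lp_class p (\<lambda>t. f' t + g' t) = Lp_class p (\<lambda>t. f t + g t)"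
    if "f' \<in> Lp_class p f" "g' \<in> Lp_class p g" for f' g'
  proof (rule Lp_class_cong)
    show "AE t in lebesgue_on {0..1}. f' t + g' t = f t + g t"
      using Lp_classD[OF that(1)] Lp_classD[OF that(2)] by eventually_elim simp
  qed
  moreover have "Lp_class p f \<noteq> {}" "Lp_class p g \<noteq> {}"
    using Lp_class_self[OF assms(1)] Lp_class_self[OF assms(2)] by blast+
  ultimately show ?thesis
    by (simp add: Lp_def cong: SUP_cong)
qed

lemma smult_Lp:
  assumes "f \<in> Lp_functions p"
  shows "c \<odot>\<^bsub>Lp p\<^esub> Lp_class p f = Lp_class p (\<lambda>t. c *\<^sub>R f t)"
proof -
  have "Lp_class p (\<lambda>t. c *\<^sub>R f' t) = Lp_class p (\<lambda>t. c *\<^sub>R f t)" if "f' \<in> Lp_class p f" for f'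
  proof (rule Lp_class_cong)
    show "AE t in lebesgue_on {0..1}. c *\<^sub>R f' t = c *\<^sub>R f t"
      using Lp_classD[OF that] by eventually_elim simp
  qed
  moreover have "Lp_class p f \<noteq> {}"
    using Lp_class_self[OF assms] by blast
  ultimately show ?thesis
    by (simp add: Lp_def cong: SUP_cong)
qed

lemma vnorm_Lp:
  assumes "f \<in> Lp_functions p"
  shows "vnorm (Lp p) (Lp_class p f) = (\<integral>t. norm (f t) powr p \<partial>lebesgue_on {0..1}) powr (1 / p)"
proof -
  define g where "g = (SOME g. g \<in> Lp_class p f)"
  have g: "g \<in> Lp_class p f"
    unfolding g_def by (rule someI[where P = "\<lambda>g. g \<in> Lp_class p f", OF Lp_class_self[OF assms]])
  have "(\<integral>t. norm (g t) powr p \<partial>lebesgue_on {0..1}) = (\<integral>t. norm (f t) powr p \<partial>lebesgue_on {0..1})"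
  proof (rule integral_cong_AE)
    show "AE t in lebesgue_on {0..1}. norm (g t) powr p = norm (f t) powr p"
      using Lp_classD[OF g] by eventually_elim simp
  qed (use g assms in \<open>auto simp: Lp_class_def Lp_functions_def\<close>)
  then show ?thesis
    by (simp add: Lp_def g_def)
qed

text \<open>Intervals of lengths \<open>w a\<close> are laid end to end. Arbitrary nonnegative
  weights let the induction append one interval at a time, and the gauge integral glues directly
  over adjacent intervals.\<close>

lemma consecutive_intervals:
  fixes w :: "'a \<Rightarrow> real"
  assumes "finite A" "\<And>a. 0 \<le> w a"
  shows "\<exists>\<phi> :: real \<Rightarrow> 'a. finite (range \<phi>) \<and> (\<forall>y. \<phi> -` {y} \<in> sets borel) \<and>
    (\<forall>f :: 'a \<Rightarrow> real. ((\<lambda>t. f (\<phi> t)) has_integral (\<Sum>a\<in>A. w a * f a)) {0..\<Sum>a\<in>A. w a})"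
  using assms(1)
proof induction
  case empty
  have "(\<lambda>_. undefined) -` {y} \<in> sets borel" for y :: 'a
    by (cases "y = undefined") auto
  then show ?case
    by (intro exI[of _ "\<lambda>_. undefined"]) (auto intro!: has_integral_refl)
next
  case (insert a A)
  then obtain \<phi> :: "real \<Rightarrow> 'a" where \<phi>: "finite (range \<phi>)" "\<And>y. \<phi> -` {y} \<in> sets borel"
    "\<And>f :: 'a \<Rightarrow> real. ((\<lambda>t. f (\<phi> t)) has_integral (\<Sum>a\<in>A. w a * f a)) {0..\<Sum>a\<in>A. w a}"
    by blast
  define r where "r = (\<Sum>a\<in>A. w a)"
  have r: "0 \<le> r"
    unfolding r_def using assms(2) by (intro sum_nonneg)
  define \<psi> where "\<psi> t = (if t \<le> r then \<phi> t else a)" for t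
  have "finite (range \<psi>)"
    by (rule finite_subset[of _ "insert a (range \<phi>)"]) (use \<phi>(1) in \<open>auto simp: \<psi>_def\<close>)
  moreover have "\<psi> -` {y} \<in> sets borel" for y
  proof -
    have "\<psi> -` {y} = (\<phi> -` {y} \<inter> {..r}) \<union> (if y = a then {r<..} else {})"
      by (auto simp: \<psi>_def split: if_splits)
    then show ?thesis
      using \<phi>(2)[of y] by simp
  qed
  moreover have "((\<lambda>t. f (\<psi> t)) has_integral (\<Sum>a\<in>insert a A. w a * f a)) {0..\<Sum>a\<in>insert a A. w a}"
    for f :: "'a \<Rightarrow> real"
  proof -
    have "((\<lambda>t. f (\<psi> t)) has_integral ((\<Sum>a\<in>A. w a * f a) + w a * f a)) {0..r + w a}"
    proof (rule has_integral_combine[OF r])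
      show "((\<lambda>t. f (\<psi> t)) has_integral (\<Sum>a\<in>A. w a * f a)) {0..r}"
        by (rule has_integral_eq[OF _ \<phi>(3)[of f, folded r_def]]) (simp add: \<psi>_def)
      have "((\<lambda>_. f a) has_integral (w a * f a)) {r..r + w a}"
        using has_integral_const_real[of "f a" r "r + w a"] assms(2) by simp
      then show "((\<lambda>t. f (\<psi> t)) has_integral (w a * f a)) {r..r + w a}"
        by (rule has_integral_spike_finite[of "{r}", rotated 2]) (auto simp: \<psi>_def)
    qed (use assms(2) in simp)
    then show ?thesis
      using insert.hyps by (simp add: r_def add.commute)
  qed
  ultimately show ?case
    by blast
qed

text \<open>\<open>simple_function\<close> demands no structure on the target type, so
  \<open>\<phi>\<close> may take values in a bare set of points, and its composite with any real
  function on that set is simple and bounded, hence integrable.\<close>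

lemma convex_weights_realization:
  fixes w :: "'a \<Rightarrow> real"
  assumes "convex_weights w"
  obtains \<phi> :: "real \<Rightarrow> 'a" where "simple_function (lebesgue_on {0..1}) \<phi>"
    "\<And>f :: 'a \<Rightarrow> real. integrable (lebesgue_on {0..1}) (\<lambda>t. f (\<phi> t))"
    "\<And>f :: 'a \<Rightarrow> real. (\<integral>t. f (\<phi> t) \<partial>lebesgue_on {0..1}) = weighted_mean w f"
proof -
  obtain \<phi> :: "real \<Rightarrow> 'a" where \<phi>: "finite (range \<phi>)" "\<And>y. \<phi> -` {y} \<in> sets borel"
    "\<And>f :: 'a \<Rightarrow> real. ((\<lambda>t. f (\<phi> t)) has_integral weighted_mean w f) {0..1}"
    using consecutive_intervals[of "{x. w x \<noteq> 0}" w] assms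
    by (auto simp: convex_weights_def weighted_mean_def)
  have simple: "simple_function (lebesgue_on {0..1}) \<phi>"
    unfolding simple_function_def
  proof (intro conjI ballI)
    show "finite (\<phi> ` space (lebesgue_on {0..1}))"
      using \<phi>(1) by (rule rev_finite_subset) auto
    have "\<phi> -` {y} \<inter> {0..1} \<in> sets lebesgue" for y
      using \<phi>(2) by (intro sets.Int) auto
    then show "\<phi> -` {y} \<inter> space (lebesgue_on {0..1}) \<in> sets (lebesgue_on {0..1})" for y
      by (auto simp: sets_restrict_space_iff space_restrict_space)
  qed
  have int: "integrable (lebesgue_on {0..1}) (\<lambda>t. f (\<phi> t))" for f :: "'a \<Rightarrow> real"
  proof -
    have "finite (range (\<lambda>t. f (\<phi> t)))"
      using finite_imageI[OF \<phi>(1), of f] by (simp add: image_image)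
    then have "bounded (range (\<lambda>t. f (\<phi> t)))"
      by (rule finite_imp_bounded)
    then obtain K where K: "\<And>t. norm (f (\<phi> t)) \<le> K"
      by (auto simp: bounded_iff)
    have "finite_measure (lebesgue_on {0..1::real})"
      by (intro finite_measure_lebesgue_on) simp
    moreover have "AE t in lebesgue_on {0..1}. norm (f (\<phi> t)) \<le> K"
      using K by simp
    moreover have "(\<lambda>t. f (\<phi> t)) \<in> borel_measurable (lebesgue_on {0..1})"
      using simple_function_compose[OF simple, of f]
      by (simp add: borel_measurable_simple_function comp_def)
    ultimately show ?thesis
      by (rule finite_measure.integrable_const_bound)
  qed
  moreover have "(\<integral>t. f (\<phi> t) \<partial>lebesgue_on {0..1}) = weighted_mean w f" for f :: "'a \<Rightarrow> real"
    using lebesgue_integral_eq_integral[OF int] integral_unique[OF \<phi>(3)] by simp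
  ultimately show ?thesis
    using that simple by blast
qed

section \<open>Finite representability of the completion\<close>

context mean
begin

text \<open>\<open>convex_approximation\<close> controls finitely many functions, while all
  combinations are at stake. By homogeneity the coefficient sphere suffices, and on it both
  seminorms are Lipschitz with a common constant, which reduces the claim to a finite net
  \<open>D\<close>. Three errors of \<open>e / 4\<close> stay below \<open>e\<close>.\<close>

lemma uniform_norm_approximation:
  fixes f :: "'i \<Rightarrow> 'g \<Rightarrow> 'e::real_normed_vector"
  assumes p: "p \<ge> 1" and B: "finite B" and f: "\<And>b. b \<in> B \<Longrightarrow> f b \<in> vector_RUC" and "e > 0"
  obtains w where "convex_weights w"
    "\<And>c. \<bar>Lp_mean (weighted_mean w) p (\<Sum>b\<in>B. c b *\<^sub>R f b) - Lp_mean \<mu> p (\<Sum>b\<in>B. c b *\<^sub>R f b)\<bar>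
      \<le> e * (\<Sum>b\<in>B. \<bar>c b\<bar>)"
proof -
  interpret \<mu>: seminormed "vector_RUC :: ('g \<Rightarrow> 'e) set" "Lp_mean \<mu> p"
    by (rule seminormed_Lp_mean[OF p])
  have "\<exists>K. \<forall>x. norm (f b x) \<le> K" if "b \<in> B" for b
    using vector_RUC_bounded[OF f[OF that]] by metis
  then obtain k where k: "\<And>b x. b \<in> B \<Longrightarrow> norm (f b x) \<le> k b"
    by metis
  \<comment> \<open>A uniform bound on the maps bounds their seminorms for every mean. This settles
    the order of choices: the net is fixed through \<open>K\<close> before \<open>w\<close> is
    known. The summand 1 makes \<open>K\<close> positive even for empty \<open>B\<close>.\<close>
  define K where "K = (\<Sum>b\<in>B. \<bar>k b\<bar>) + 1"
  have K: "norm (f b x) \<le> K" if "b \<in> B" for b x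
    using k[OF that, of x] member_le_sum[OF that, of "\<lambda>b. \<bar>k b\<bar>"] B by (simp add: K_def)
  have "K > 0"
    unfolding K_def by (rule add_nonneg_pos) (auto intro: sum_nonneg)
  define h where "h c = (\<Sum>b\<in>B. c b *\<^sub>R f b)" for c
  have h: "h c \<in> vector_RUC" for c
    unfolding h_def using f by (intro \<mu>.sum_closed \<mu>.closed)
  have "e / (4 * K) > 0"
    using \<open>K > 0\<close> \<open>e > 0\<close> by simp
  from B this obtain D where D: "finite D" "\<And>c. (\<Sum>b\<in>B. \<bar>c b\<bar>) = 1 \<Longrightarrow> \<exists>c'\<in>D. (\<Sum>b\<in>B. \<bar>c b - c' b\<bar>) < e / (4 * K)"
    by (rule finite_coefficient_net) (rule that)
  \<comment> \<open>The tolerance on p-th powers is such that \<open>powr_diff_le\<close> returns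
    \<open>e / 4\<close> for the seminorms themselves.\<close>
  have "(e / 4) powr p > 0"
    using \<open>e > 0\<close> by simp
  then obtain w where w: "convex_weights w"
    "\<And>c. c \<in> D \<Longrightarrow> \<bar>weighted_mean w (\<lambda>x. norm (h c x) powr p) - \<mu> (\<lambda>x. norm (h c x) powr p)\<bar> < (e / 4) powr p"
    using convex_approximation[OF D(1), of "\<lambda>c x. norm (h c x) powr p" "(e / 4) powr p"]
      vector_RUC_norm_powr[OF h p] by blast
  interpret \<nu>: mean "weighted_mean w :: ('g \<Rightarrow> real) \<Rightarrow> real"
    by (rule mean_weighted_mean[OF w(1)])
  interpret \<nu>: seminormed "vector_RUC :: ('g \<Rightarrow> 'e) set" "Lp_mean (weighted_mean w) p"
    by (rule \<nu>.seminormed_Lp_mean[OF p])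
  have lipschitz: "\<bar>M (h c) - M (h c')\<bar> \<le> e / 4"
    if "seminormed (vector_RUC :: ('g \<Rightarrow> 'e) set) M" "\<And>b. b \<in> B \<Longrightarrow> M (f b) \<le> K"
      "(\<Sum>b\<in>B. \<bar>c b - c' b\<bar>) < e / (4 * K)" for M c c'
  proof -
    have "\<bar>M (h c) - M (h c')\<bar> \<le> (\<Sum>b\<in>B. \<bar>c b - c' b\<bar> * M (f b))"
      unfolding h_def by (rule seminormed.coefficient_diff_le[OF that(1)]) (rule f)
    also have "\<dots> \<le> (\<Sum>b\<in>B. \<bar>c b - c' b\<bar> * K)"
      using that(2) by (intro sum_mono mult_left_mono) auto
    also have "\<dots> = (\<Sum>b\<in>B. \<bar>c b - c' b\<bar>) * K"
      by (simp add: sum_distrib_right)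
    also have "\<dots> \<le> e / (4 * K) * K"
      using that(3) \<open>K > 0\<close> by (intro mult_right_mono) auto
    finally show ?thesis
      using \<open>K > 0\<close> by simp
  qed
  have unit: "\<bar>Lp_mean (weighted_mean w) p (h c) - Lp_mean \<mu> p (h c)\<bar> \<le> e" if c: "(\<Sum>b\<in>B. \<bar>c b\<bar>) = 1" for c
  proof -
    obtain c' where c': "c' \<in> D" "(\<Sum>b\<in>B. \<bar>c b - c' b\<bar>) < e / (4 * K)"
      using D(2)[OF c] by blast
    let ?a = "Lp_mean (weighted_mean w) p (h c')" and ?b = "Lp_mean \<mu> p (h c')"
    have "\<bar>?a - ?b\<bar> powr p \<le> \<bar>?a powr p - ?b powr p\<bar>"
      by (intro powr_diff_le p Lp_mean_nonneg \<nu>.Lp_mean_nonneg)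
    also have "\<dots> < (e / 4) powr p"
      unfolding Lp_mean_powr[OF h p] \<nu>.Lp_mean_powr[OF h p] by (rule w(2)[OF c'(1)])
    finally have "\<bar>?a - ?b\<bar> powr p < (e / 4) powr p" .
    then have "\<bar>?a - ?b\<bar> < e / 4"
      using p \<open>e > 0\<close> powr_mono2[of p "e / 4" "\<bar>?a - ?b\<bar>"] by (meson divide_pos_pos leD leI
          less_imp_le order_trans zero_le_one zero_less_numeral)
    moreover have "\<bar>Lp_mean \<mu> p (h c) - ?b\<bar> \<le> e / 4"
      using c'(2) K \<open>K > 0\<close>
      by (intro lipschitz \<mu>.seminormed_axioms Lp_mean_le f p) auto
    moreover have "\<bar>Lp_mean (weighted_mean w) p (h c) - ?a\<bar> \<le> e / 4"
      using c'(2) K \<open>K > 0\<close>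
      by (intro lipschitz \<nu>.seminormed_axioms \<nu>.Lp_mean_le f p) auto
    ultimately show ?thesis
      using \<open>e > 0\<close> by linarith
  qed
  have "\<bar>Lp_mean (weighted_mean w) p (h c) - Lp_mean \<mu> p (h c)\<bar> \<le> e * (\<Sum>b\<in>B. \<bar>c b\<bar>)" for c
  proof (cases "(\<Sum>b\<in>B. \<bar>c b\<bar>) > 0")
    case True
    define s where "s = (\<Sum>b\<in>B. \<bar>c b\<bar>)"
    have s: "s > 0"
      using True by (simp add: s_def)
    have hs: "h c = s *\<^sub>R h (\<lambda>b. c b / s)"
      using s by (simp add: h_def scaleR_sum_right)
    have "\<bar>Lp_mean (weighted_mean w) p (h c) - Lp_mean \<mu> p (h c)\<bar>
        = s * \<bar>Lp_mean (weighted_mean w) p (h (\<lambda>b. c b / s)) - Lp_mean \<mu> p (h (\<lambda>b. c b / s))\<bar>"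
      unfolding hs \<mu>.scale[OF h] \<nu>.scale[OF h]
      using s by (simp add: abs_mult flip: right_diff_distrib)
    also have "\<dots> \<le> s * e"
      using s sum_abs_normalized[OF True] by (intro mult_left_mono unit) (auto simp: s_def)
    finally show ?thesis
      by (simp add: s_def mult.commute)
  next
    case False
    then have "(\<Sum>b\<in>B. \<bar>c b\<bar>) = 0"
      by (metis abs_ge_zero order_le_less sum_nonneg)
    then have "\<forall>b\<in>B. c b = 0"
      using B by (simp add: sum_nonneg_eq_0_iff)
    then have "h c = 0"
      by (simp add: h_def)
    then show ?thesis
      using \<open>(\<Sum>b\<in>B. \<bar>c b\<bar>) = 0\<close> \<mu>.zero \<nu>.zero by simp
  qed
  then show ?thesis
    using that w(1) unfolding h_def by blast
qed

text \<open>Each half of \<open>\<delta>\<close> pays for one approximation: replacing the sequences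
  by their terms at a late index, and replacing the mean by a weighted one.\<close>

lemma finitely_representable_completion:
  assumes p: "p \<ge> 1"
  shows "finitely_representable
    (seminorm_quotient (cauchy_sequences (vector_RUC :: ('g \<Rightarrow> 'e::banach) set) (Lp_mean \<mu> p))
      (limit_seminorm (Lp_mean \<mu> p)))
    (Lp p :: (real \<Rightarrow> 'e) set normed_space)"
proof -
  interpret V: seminormed "vector_RUC :: ('g \<Rightarrow> 'e) set" "Lp_mean \<mu> p"
    by (rule seminormed_Lp_mean[OF p])
  interpret W: seminormed V.C V.L
    by (rule V.seminormed_completion)
  show ?thesis
  proof (rule W.finitely_representableI)
    fix B :: "(nat \<Rightarrow> 'g \<Rightarrow> 'e) set" and \<delta> :: real
    assume B: "finite B" "B \<subseteq> V.C" and "\<delta> > 0"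
    have "\<exists>M. \<forall>m\<ge>M. V.L (b - (\<lambda>_. b m)) < \<delta> / 2" if "b \<in> B" for b
      using V.limit_seminorm_approx[of b "\<delta> / 2"] B(2) that \<open>\<delta> > 0\<close> by auto
    then obtain M where M: "\<And>b m. \<lbrakk>b \<in> B; m \<ge> M b\<rbrakk> \<Longrightarrow> V.L (b - (\<lambda>_. b m)) < \<delta> / 2"
      by metis
    \<comment> \<open>A sum of natural numbers dominates each summand, so \<open>n\<close> is late
      enough for every member of \<open>B\<close>.\<close>
    define n where "n = (\<Sum>b\<in>B. M b)"
    have n: "V.L (b - (\<lambda>_. b n)) < \<delta> / 2" if "b \<in> B" for b
      using that B(1) by (intro M) (auto simp: n_def intro: member_le_sum)
    have bn: "b n \<in> vector_RUC" if "b \<in> B" for b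
      using V.C_closed B(2) that by blast
    have "\<delta> / 2 > 0"
      using \<open>\<delta> > 0\<close> by simp
    from p B(1) bn this obtain w where w: "convex_weights w"
      "\<And>c. \<bar>Lp_mean (weighted_mean w) p (\<Sum>b\<in>B. c b *\<^sub>R b n) - Lp_mean \<mu> p (\<Sum>b\<in>B. c b *\<^sub>R b n)\<bar>
        \<le> \<delta> / 2 * (\<Sum>b\<in>B. \<bar>c b\<bar>)"
      by (rule uniform_norm_approximation) (assumption, rule that)
    obtain \<phi> :: "real \<Rightarrow> 'g" where \<phi>: "simple_function (lebesgue_on {0..1}) \<phi>"
      "\<And>f :: 'g \<Rightarrow> real. integrable (lebesgue_on {0..1}) (\<lambda>t. f (\<phi> t))"
      "\<And>f :: 'g \<Rightarrow> real. (\<integral>t. f (\<phi> t) \<partial>lebesgue_on {0..1}) = weighted_mean w f"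
      using w(1) by (rule convex_weights_realization) (rule that)
    \<comment> \<open>Evaluation at one index followed by composition with \<open>\<phi>\<close> is
      linear on all sequences, though it need not send null vectors to 0.\<close>
    define T where "T s = Lp_class p (\<lambda>t. s n (\<phi> t))" for s :: "nat \<Rightarrow> 'g \<Rightarrow> 'e"
    have Lp: "(\<lambda>t. f (\<phi> t)) \<in> Lp_functions p" for f :: "'g \<Rightarrow> 'e"
    proof -
      have "simple_function (lebesgue_on {0..1}) (\<lambda>t. f (\<phi> t))"
        using simple_function_compose[OF \<phi>(1), of f] by (simp add: comp_def)
      then have "bochner_measurable (\<lambda>t. f (\<phi> t))"
        unfolding bochner_measurable_def by (intro exI[of _ "\<lambda>_ t. f (\<phi> t)"]) simp
      then show ?thesis
        using \<phi>(2)[of "\<lambda>x. norm (f x) powr p"] by (simp add: Lp_functions_def)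
    qed
    have norm_T: "vnorm (Lp p) (T s) = Lp_mean (weighted_mean w) p (s n)" for s
      unfolding T_def vnorm_Lp[OF Lp] Lp_mean_def \<phi>(3)[of "\<lambda>x. norm (s n x) powr p"] ..
    have "\<bar>vnorm (Lp p) (T (\<Sum>b\<in>B. c b *\<^sub>R b)) - V.L (\<Sum>b\<in>B. c b *\<^sub>R b)\<bar> \<le> \<delta> * (\<Sum>b\<in>B. \<bar>c b\<bar>)" for c
    proof -
      let ?s = "\<Sum>b\<in>B. c b *\<^sub>R b"
      have sC: "?s \<in> V.C"
        using B(2) by (intro W.sum_closed W.closed) auto
      have sn: "?s n = (\<Sum>b\<in>B. c b *\<^sub>R b n)"
        by (simp add: sum_fun_apply)
      have "\<bar>V.L ?s - Lp_mean \<mu> p (?s n)\<bar> \<le> V.L (?s - (\<lambda>_. ?s n))"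
        using W.abs_diff[OF sC V.const_in_C[OF V.C_closed[OF sC, of n]]]
        by (simp add: V.limit_seminorm_const)
      also have "?s - (\<lambda>_. ?s n) = (\<Sum>b\<in>B. c b *\<^sub>R (b - (\<lambda>_. b n)))"
        by (intro ext) (simp add: sum_fun_apply scaleR_diff_right sum_subtractf)
      also have "V.L \<dots> \<le> (\<Sum>b\<in>B. V.L (c b *\<^sub>R (b - (\<lambda>_. b n))))"
        using B(2) V.const_in_C[OF bn] by (intro W.sum_le W.closed) auto
      also have "\<dots> = (\<Sum>b\<in>B. \<bar>c b\<bar> * V.L (b - (\<lambda>_. b n)))"
        using B(2) V.const_in_C[OF bn] by (intro sum.cong W.scale W.closed) auto
      also have "\<dots> \<le> (\<Sum>b\<in>B. \<bar>c b\<bar> * (\<delta> / 2))"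
        using n by (intro sum_mono mult_left_mono) (auto intro: less_imp_le)
      also have "\<dots> = \<delta> / 2 * (\<Sum>b\<in>B. \<bar>c b\<bar>)"
        by (simp add: sum_distrib_left mult.commute)
      finally have "\<bar>V.L ?s - Lp_mean \<mu> p (?s n)\<bar> \<le> \<delta> / 2 * (\<Sum>b\<in>B. \<bar>c b\<bar>)" .
      moreover have "\<bar>vnorm (Lp p) (T ?s) - Lp_mean \<mu> p (?s n)\<bar> \<le> \<delta> / 2 * (\<Sum>b\<in>B. \<bar>c b\<bar>)"
        unfolding norm_T sn by (rule w(2))
      ultimately show ?thesis
        by linarith
    qed
    moreover have "T (s + s') = T s \<oplus>\<^bsub>Lp p\<^esub> T s'" for s s'
      by (simp add: T_def add_Lp[OF Lp Lp])
    moreover have "T (c *\<^sub>R s) = c \<odot>\<^bsub>Lp p\<^esub> T s" for c s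
      by (simp add: T_def smult_Lp[OF Lp])
    moreover have "T s \<in> carrier (Lp p)" for s
      unfolding T_def by (rule carrier_Lp[OF Lp])
    ultimately show "\<exists>T. (\<forall>x\<in>V.C. T x \<in> carrier (Lp p :: (real \<Rightarrow> 'e) set normed_space)) \<and>
        (\<forall>x\<in>V.C. \<forall>y\<in>V.C. T (x + y) = T x \<oplus>\<^bsub>Lp p\<^esub> T y) \<and>
        (\<forall>c. \<forall>x\<in>V.C. T (c *\<^sub>R x) = c \<odot>\<^bsub>Lp p\<^esub> T x) \<and>
        (\<forall>c. \<bar>vnorm (Lp p) (T (\<Sum>b\<in>B. c b *\<^sub>R b)) - V.L (\<Sum>b\<in>B. c b *\<^sub>R b)\<bar> \<le> \<delta> * (\<Sum>b\<in>B. \<bar>c b\<bar>))"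
      by (intro exI[of _ T] conjI ballI allI)
  qed
qed

end

section \<open>The translation representation and its cocycles\<close>

text \<open>The inverse of \<open>g\<close> makes this a left action even in a noncommutative group,
  as \<open>translate_add\<close> records.\<close>

definition translate :: "'g::group_add \<Rightarrow> (nat \<Rightarrow> 'g \<Rightarrow> 'e) \<Rightarrow> nat \<Rightarrow> 'g \<Rightarrow> 'e" where
  "translate g s = (\<lambda>n x. s n (- g + x))"

lemma linear_translate: "linear (translate g :: (nat \<Rightarrow> 'g::group_add \<Rightarrow> 'e::real_vector) \<Rightarrow> _)"
  by (intro linearI ext) (simp_all add: translate_def)

lemma translate_add: "translate (g + h) s = translate g (translate h s)"
  by (simp add: translate_def minus_add add.assoc del: add_uminus_conv_diff)

lemma translate_zero: "translate 0 s = s"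
  by (simp add: translate_def)

text \<open>A left translation conjugates right quotients,
  \<open>(g + x) - (g + y) = g + (x - y) - g\<close>, so right uniform continuity survives with a
  conjugated neighbourhood.\<close>

lemma vector_RUC_translate:
  fixes f :: "'g::topological_group_add \<Rightarrow> 'e::real_normed_vector"
  assumes f: "f \<in> vector_RUC"
  shows "(\<lambda>x. f (g + x)) \<in> vector_RUC"
  unfolding vector_RUC_def
proof (intro CollectI conjI allI impI)
  show "bounded (range (\<lambda>x. f (g + x)))"
    by (rule bounded_subset[of "range f"]) (use f in \<open>auto simp: vector_RUC_def\<close>)
  fix e :: real assume "e > 0"
  then obtain U where U: "open U" "0 \<in> U" "\<And>x y. x - y \<in> U \<Longrightarrow> norm (f x - f y) < e"
    using vector_RUC_uniform[OF f] by metis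
  have "open ((\<lambda>u. g + u - g) -` U)"
    using U(1) by (intro open_vimage continuous_intros)
  moreover have "(g + x) - (g + y) = g + (x - y) - g" for x y
    by (simp add: diff_conv_add_uminus minus_add add.assoc del: add_uminus_conv_diff)
  ultimately show "\<exists>U. open U \<and> 0 \<in> U \<and> (\<forall>x y. x - y \<in> U \<longrightarrow> norm (f (g + x) - f (g + y)) < e)"
    using U(2,3) by (intro exI[of _ "(\<lambda>u. g + u - g) -` U"]) auto
qed

locale invariant_mean = mean \<mu> for \<mu> :: "('g::topological_group_add \<Rightarrow> real) \<Rightarrow> real" +
  assumes invariant: "f \<in> RUC_b \<Longrightarrow> \<mu> (\<lambda>x. f (g + x)) = \<mu> f"
begin

lemma Lp_mean_translate:
  assumes "f \<in> vector_RUC" "p \<ge> 1"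
  shows "Lp_mean \<mu> p (\<lambda>x. f (g + x)) = Lp_mean \<mu> p f"
  using invariant[OF vector_RUC_norm_powr[OF assms]] by (simp add: Lp_mean_def)

text \<open>Invariance of the mean gives isometry, and the inverse translation gives surjectivity.
  Strong continuity is a three-term estimate: approximate \<open>s\<close> by a constant sequence
  \<open>f\<close>, move \<open>f\<close> from \<open>g\<close> to \<open>h\<close>, and return,
  translations being isometric.\<close>

lemma isometric_representation_translate:
  fixes p :: real
  assumes p: "p \<ge> 1"
  defines "C \<equiv> cauchy_sequences (vector_RUC :: ('g \<Rightarrow> 'e::real_normed_vector) set) (Lp_mean \<mu> p)"
    and "L \<equiv> limit_seminorm (Lp_mean \<mu> p)"
  shows "\<And>g. translate g ` C = C" "\<And>g s. s \<in> C \<Longrightarrow> L (translate g s) = L s"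
    "isometric_representation (seminorm_quotient C L) (\<lambda>g A. translate g ` A)"
proof -
  interpret V: seminormed "vector_RUC :: ('g \<Rightarrow> 'e) set" "Lp_mean \<mu> p"
    by (rule seminormed_Lp_mean[OF p])
  interpret W: seminormed C L
    unfolding C_def L_def by (rule V.seminormed_completion)
  have closed: "translate g s \<in> C" if s: "s \<in> C" for g and s :: "nat \<Rightarrow> 'g \<Rightarrow> 'e"
  proof -
    have sn: "s n \<in> vector_RUC" for n
      using V.C_closed s unfolding C_def by blast
    have "Lp_mean \<mu> p (translate g s m - translate g s n) = Lp_mean \<mu> p (s m - s n)" for m n
      using Lp_mean_translate[OF V.closed(4)[OF sn[of m] sn[of n]] p, where g = "- g"]
      by (simp add: translate_def fun_diff_def)
    then show ?thesis
      using s vector_RUC_translate[OF sn, where g = "- g"]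
      by (simp add: C_def cauchy_sequences_def) (simp add: translate_def)
  qed
  show onto: "translate g ` C = C" for g
  proof
    show "translate g ` C \<subseteq> C"
      using closed by blast
    show "C \<subseteq> translate g ` C"
    proof
      fix s assume "s \<in> C"
      moreover have "s = translate g (translate (- g) s)"
        by (simp add: translate_zero flip: translate_add)
      ultimately show "s \<in> translate g ` C"
        using closed by blast
    qed
  qed
  show iso: "L (translate g s) = L s" if s: "s \<in> C" for g and s :: "nat \<Rightarrow> 'g \<Rightarrow> 'e"
  proof -
    have "Lp_mean \<mu> p (translate g s n) = Lp_mean \<mu> p (s n)" for n
      using Lp_mean_translate[OF V.C_closed[OF s[unfolded C_def], of n] p, where g = "- g"]
      by (simp add: translate_def)
    then show ?thesis
      by (simp add: L_def limit_seminorm_def)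
  qed
  show "isometric_representation (seminorm_quotient C L) (\<lambda>g A. translate g ` A)"
  proof (rule W.isometric_representation_quotient[OF linear_translate onto iso translate_add])
    fix s :: "nat \<Rightarrow> 'g \<Rightarrow> 'e" and g :: 'g and e :: real assume s: "s \<in> C" and "e > 0"
    then obtain m where m: "L (s - (\<lambda>_. s m)) < e / 3"
      using V.limit_seminorm_approx[of s "e / 3"] by (auto simp: C_def L_def)
    define f where "f = s m"
    have f: "f \<in> vector_RUC"
      using V.C_closed s unfolding C_def f_def by blast
    have fC: "(\<lambda>_. f) \<in> C"
      unfolding C_def by (rule V.const_in_C[OF f])
    have "e / 3 > 0"
      using \<open>e > 0\<close> by simp
    then obtain U where U: "open U" "0 \<in> U" "\<And>x y. x - y \<in> U \<Longrightarrow> norm (f x - f y) < e / 3"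
      using vector_RUC_uniform[OF f] by metis
    have "L (translate g s - translate h s) < e" if h: "- g + h \<in> U" for h
    proof -
      let ?f = "\<lambda>_::nat. f"
      have C: "translate k s \<in> C" "translate k ?f \<in> C" for k
        using closed s fC by auto
      have dist_f: "L (translate k s - translate k ?f) < e / 3" for k
        using iso[OF W.closed(4)[OF s fC], of k] m by (simp add: linear_diff[OF linear_translate] f_def)
      have RUC: "(\<lambda>x. f (- g + x)) - (\<lambda>x. f (- h + x)) \<in> vector_RUC"
        by (intro V.closed vector_RUC_translate f)
      \<comment> \<open>Right uniform continuity enters here: this quotient is the same for every
        \<open>x\<close>, so the two translates of \<open>f\<close> are uniformly close once
        \<open>- g + h\<close> lies in \<open>U\<close>.\<close>
      have "(- g + x) - (- h + x) = - g + h" for x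
        by (simp add: diff_conv_add_uminus minus_add add.assoc del: add_uminus_conv_diff)
      then have "Lp_mean \<mu> p ((\<lambda>x. f (- g + x)) - (\<lambda>x. f (- h + x))) \<le> e / 3"
        using U(3) h \<open>e > 0\<close> by (intro Lp_mean_le RUC p) (auto intro: less_imp_le)
      moreover have "translate g ?f - translate h ?f = (\<lambda>_. (\<lambda>x. f (- g + x)) - (\<lambda>x. f (- h + x)))"
        by (simp add: translate_def fun_diff_def)
      ultimately have "L (translate g ?f - translate h ?f) \<le> e / 3"
        unfolding L_def by (simp only: V.limit_seminorm_const)
      moreover have "L (translate h ?f - translate h s) < e / 3"
        using dist_f[of h] W.minus_commute[of "translate h s" "translate h ?f"] C by auto
      ultimately show ?thesis
        using W.triangle3[OF C(1)[of g] C(2)[of g] C(1)[of h]] dist_f[of g]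
          W.triangle3[OF C(2)[of g] C(2)[of h] C(1)[of h]] by linarith
    qed
    moreover have "open ((\<lambda>h. - g + h) -` U)"
      using U(1) by (intro open_vimage continuous_intros)
    ultimately show "\<exists>U. open U \<and> g \<in> U \<and> (\<forall>h\<in>U. L (translate g s - translate h s) < e)"
      using U(2) by (intro exI[of _ "(\<lambda>h. - g + h) -` U"]) auto
  qed
qed

end

text \<open>Inverting the argument turns left-invariance of \<open>d\<close> into the pointwise bounds
  \<open>d (- x + g) (- x + h) = d g h\<close>.\<close>

definition orbit_difference :: "('g::group_add \<Rightarrow> 'e::ab_group_add) \<Rightarrow> 'g \<Rightarrow> 'g \<Rightarrow> 'e" where
  "orbit_difference \<sigma> g = (\<lambda>x. \<sigma> (- x + g) - \<sigma> (- x))"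

text \<open>Formally this is the coboundary of \<open>\<lambda>x. \<sigma> (- x)\<close>, its
  translate by \<open>g\<close> minus itself, so the identity telescopes. That map may be unbounded,
  hence the cocycle need not be a coboundary within the space.\<close>

lemma orbit_difference_add:
  "orbit_difference \<sigma> (g + h) = (\<lambda>x. orbit_difference \<sigma> h (- g + x)) + orbit_difference \<sigma> g"
  by (intro ext) (simp add: orbit_difference_def minus_add add.assoc)

text \<open>Left-invariance puts the translated pair at exactly the same distance, so it competes
  both in the infimum over equal distances and in the supremum.\<close>

lemma modulus_bounds:
  assumes "left_invariant d"
  shows "exact_compression_modulus d dist \<sigma> (ennreal (d x y)) \<le> ennreal (dist (\<sigma> (z + x)) (\<sigma> (z + y)))"
    "ennreal (dist (\<sigma> (z + x)) (\<sigma> (z + y))) \<le> expansion_modulus d dist \<sigma> (ennreal (d x y))"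
proof -
  have d: "d (z + x) (z + y) = d x y"
    using assms by (simp add: left_invariant_def)
  show "exact_compression_modulus d dist \<sigma> (ennreal (d x y)) \<le> ennreal (dist (\<sigma> (z + x)) (\<sigma> (z + y)))"
    unfolding exact_compression_modulus_def
    by (rule Inf_lower, rule CollectI, rule exI[of _ "z + x"], rule exI[of _ "z + y"]) (simp add: d)
  show "ennreal (dist (\<sigma> (z + x)) (\<sigma> (z + y))) \<le> expansion_modulus d dist \<sigma> (ennreal (d x y))"
    unfolding expansion_modulus_def
    by (rule Sup_upper, rule CollectI, rule exI[of _ "z + x"], rule exI[of _ "z + y"]) (simp add: d)
qed

text \<open>The bound is the expansion modulus at \<open>d g 0\<close>, which is finite for a
  bornologous map and independent of the point.\<close>

lemma orbit_difference_RUC: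
  fixes \<sigma> :: "'g::topological_group_add \<Rightarrow> 'e::real_normed_vector"
  assumes d: "continuous_pseudo_metric d" "left_invariant d"
    and \<sigma>: "unif_continuous d dist \<sigma>" "bornologous d dist \<sigma>"
  shows "orbit_difference \<sigma> g \<in> vector_RUC"
  unfolding vector_RUC_def
proof (intro CollectI conjI allI impI)
  have inv: "d (z + x) (z + y) = d x y" for x y z
    using d(2) by (simp add: left_invariant_def)
  have d0: "d x x = 0" for x
    using d(1) by (simp add: continuous_pseudo_metric_def pseudo_metric_def)
  have ball: "open {y. d x y < r}" for x r
    using d(1) by (simp add: continuous_pseudo_metric_def)
  have "expansion_modulus d dist \<sigma> (ennreal (d g 0)) < \<infinity>"
    using \<sigma>(2) by (simp add: bornologous_def)
  then obtain M where M: "M \<ge> 0" "expansion_modulus d dist \<sigma> (ennreal (d g 0)) = ennreal M"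
    by (cases "expansion_modulus d dist \<sigma> (ennreal (d g 0))") auto
  have "norm (orbit_difference \<sigma> g x) \<le> M" for x
    using modulus_bounds(2)[OF d(2), where \<sigma> = \<sigma> and z = "- x" and x = g and y = 0] M
    by (simp add: orbit_difference_def dist_norm ennreal_le_iff)
  then show "bounded (range (orbit_difference \<sigma> g))"
    by (auto simp: bounded_iff)
  fix e :: real assume "e > 0"
  then obtain \<delta> where \<delta>: "\<delta> > 0" "\<And>x y. d x y < \<delta> \<Longrightarrow> dist (\<sigma> x) (\<sigma> y) < e / 2"
    using \<sigma>(1) unfolding unif_continuous_def by (meson half_gt_zero)
  \<comment> \<open>With \<open>u = x - y\<close>, left-invariance gives
    \<open>d (- x) (- y) = d 0 u\<close> and \<open>d (- x + g) (- y + g) = d g (u + g)\<close>. As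
    \<open>d\<close> need not be right-invariant, both distances have to be made small.\<close>
  let ?U = "{u. d 0 u < \<delta>} \<inter> (\<lambda>u. u + g) -` {u. d g u < \<delta>}"
  have "open ?U"
    by (intro open_Int open_vimage ball continuous_intros)
  moreover have "0 \<in> ?U"
    using \<delta>(1) d0 by simp
  moreover have "norm (orbit_difference \<sigma> g x - orbit_difference \<sigma> g y) < e" if "x - y \<in> ?U" for x y
  proof -
    have "d (- x + g) (- y + g) = d g (x - y + g)" "d (- x) (- y) = d 0 (x - y)"
      using inv[of x "- x + g" "- y + g"] inv[of x "- x" "- y"]
      by (simp_all add: add.assoc[symmetric])
    then have "dist (\<sigma> (- x + g)) (\<sigma> (- y + g)) < e / 2" "dist (\<sigma> (- x)) (\<sigma> (- y)) < e / 2"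
      using that \<delta>(2)[of "- x + g" "- y + g"] \<delta>(2)[of "- x" "- y"] by simp_all
    then have "norm ((\<sigma> (- x + g) - \<sigma> (- y + g)) - (\<sigma> (- x) - \<sigma> (- y))) < e"
      using norm_triangle_ineq4[of "\<sigma> (- x + g) - \<sigma> (- y + g)" "\<sigma> (- x) - \<sigma> (- y)"]
      by (simp add: dist_norm)
    then show ?thesis
      by (simp add: orbit_difference_def algebra_simps)
  qed
  ultimately show "\<exists>U. open U \<and> 0 \<in> U \<and>
      (\<forall>x y. x - y \<in> U \<longrightarrow> norm (orbit_difference \<sigma> g x - orbit_difference \<sigma> g y) < e)"
    by blast
qed

text \<open>The difference of \<open>b x\<close> and \<open>b y\<close> is represented by a constant
  sequence of one map. The norms of its values lie between bounds that do not depend on the point,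
  and a normalised mean preserves such bounds.\<close>

lemma (in invariant_mean) translation_cocycle:
  fixes p :: real and \<sigma> :: "'g \<Rightarrow> 'e::real_normed_vector"
  assumes p: "p \<ge> 1" and d: "continuous_pseudo_metric d" "left_invariant d"
    and \<sigma>: "unif_continuous d dist \<sigma>" "bornologous d dist \<sigma>"
  defines "V \<equiv> seminorm_quotient (cauchy_sequences (vector_RUC :: ('g \<Rightarrow> 'e) set) (Lp_mean \<mu> p))
    (limit_seminorm (Lp_mean \<mu> p))"
  shows "\<exists>b. is_cocycle V (\<lambda>g A. translate g ` A) b \<and>
    (\<forall>x y.
      exact_compression_modulus d dist \<sigma> (ennreal (d x y)) \<le> ennreal (vnorm V (b x \<ominus>\<^bsub>V\<^esub> b y)) \<and>
      ennreal (vnorm V (b x \<ominus>\<^bsub>V\<^esub> b y)) \<le> expansion_modulus d dist \<sigma> (ennreal (d x y)))"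
proof -
  interpret V: seminormed "vector_RUC :: ('g \<Rightarrow> 'e) set" "Lp_mean \<mu> p"
    by (rule seminormed_Lp_mean[OF p])
  interpret W: seminormed V.C V.L
    by (rule V.seminormed_completion)
  let ?\<beta> = "\<lambda>g (_::nat). orbit_difference \<sigma> g"
  define b where "b g = W.cls (?\<beta> g)" for g
  note RUC = orbit_difference_RUC[OF d \<sigma>]
  have \<beta>: "?\<beta> g \<in> V.C" for g
    by (rule V.const_in_C[OF RUC])
  note trans = isometric_representation_translate(1,2)[OF p, where 'e = 'e]
  have "b (x + y) = translate x ` b y \<oplus>\<^bsub>V\<^esub> b x" for x y
  proof -
    have "translate x ` b y = W.cls (translate x (?\<beta> y))"
      unfolding b_def by (rule W.image_class[OF linear_translate trans \<beta>])
    moreover have "translate x (?\<beta> y) \<in> V.C"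
      using trans(1) \<beta> by blast
    moreover have "translate x (?\<beta> y) + ?\<beta> x = ?\<beta> (x + y)"
      by (intro ext) (simp add: translate_def orbit_difference_add)
    ultimately show ?thesis
      using W.add_quotient[of "translate x (?\<beta> y)" "?\<beta> x"] \<beta> by (simp add: V_def b_def)
  qed
  then have "is_cocycle V (\<lambda>g A. translate g ` A) b"
    unfolding is_cocycle_def V_def b_def using \<beta> by auto
  moreover have "exact_compression_modulus d dist \<sigma> (ennreal (d x y)) \<le> ennreal (vnorm V (b x \<ominus>\<^bsub>V\<^esub> b y))"
    "ennreal (vnorm V (b x \<ominus>\<^bsub>V\<^esub> b y)) \<le> expansion_modulus d dist \<sigma> (ennreal (d x y))" for x y
  proof -
    let ?f = "orbit_difference \<sigma> x - orbit_difference \<sigma> y"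
    have f: "?f \<in> vector_RUC"
      by (intro V.closed RUC)
    have "?\<beta> x - ?\<beta> y = (\<lambda>_. ?f)"
      by (simp add: fun_diff_def)
    then have norm: "vnorm V (b x \<ominus>\<^bsub>V\<^esub> b y) = Lp_mean \<mu> p ?f"
      using \<beta> W.closed(4)[OF \<beta>[of x] \<beta>[of y]]
      by (simp add: V_def b_def W.minus_quotient W.vnorm_quotient V.limit_seminorm_const)
    have pointwise: "norm (?f z) = dist (\<sigma> (- z + x)) (\<sigma> (- z + y))" for z
      by (simp add: orbit_difference_def dist_norm)
    note bounds = modulus_bounds[OF d(2), where \<sigma> = \<sigma> and x = x and y = y]
    \<comment> \<open>An infimum over a nonempty set of finite values is finite, so it is a real
      number and can serve as the constant in \<open>Lp_mean_ge\<close>.\<close>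
    have "exact_compression_modulus d dist \<sigma> (ennreal (d x y)) < \<infinity>"
      using bounds(1)[of 0] by (simp add: le_less_trans)
    then obtain k where k: "k \<ge> 0" "exact_compression_modulus d dist \<sigma> (ennreal (d x y)) = ennreal k"
      by (cases "exact_compression_modulus d dist \<sigma> (ennreal (d x y))") auto
    have "k \<le> norm (?f z)" for z
      using bounds(1)[of "- z"] k unfolding pointwise by simp
    then show "exact_compression_modulus d dist \<sigma> (ennreal (d x y)) \<le> ennreal (vnorm V (b x \<ominus>\<^bsub>V\<^esub> b y))"
      unfolding k(2) norm by (intro ennreal_leI Lp_mean_ge f p k(1))
    have "expansion_modulus d dist \<sigma> (ennreal (d x y)) < \<infinity>"
      using \<sigma>(2) by (simp add: bornologous_def)
    then obtain M where M: "M \<ge> 0" "expansion_modulus d dist \<sigma> (ennreal (d x y)) = ennreal M"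
      by (cases "expansion_modulus d dist \<sigma> (ennreal (d x y))") auto
    have "norm (?f z) \<le> M" for z
      using bounds(2)[of "- z"] unfolding pointwise M(2) ennreal_le_iff[OF M(1)] .
    then show "ennreal (vnorm V (b x \<ominus>\<^bsub>V\<^esub> b y)) \<le> expansion_modulus d dist \<sigma> (ennreal (d x y))"
      unfolding M(2) norm by (intro ennreal_leI Lp_mean_le f p M(1))
  qed
  ultimately show ?thesis
    by blast
qed

lemma amenable_invariant_mean:
  assumes "amenable TYPE('g::topological_group_add)"
  obtains \<mu> :: "('g::topological_group_add \<Rightarrow> real) \<Rightarrow> real" where "invariant_mean \<mu>"
proof -
  obtain \<mu> :: "('g \<Rightarrow> real) \<Rightarrow> real" where \<mu>:
    "\<forall>f\<in>RUC_b. \<forall>h\<in>RUC_b. \<mu> (\<lambda>x. f x + h x) = \<mu> f + \<mu> h"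
    "\<forall>f\<in>RUC_b. \<forall>c. \<mu> (\<lambda>x. c * f x) = c * \<mu> f"
    "\<forall>f\<in>RUC_b. (\<forall>x. 0 \<le> f x) \<longrightarrow> 0 \<le> \<mu> f"
    "\<mu> (\<lambda>_. 1) = 1"
    "\<forall>f\<in>RUC_b. \<forall>g. \<mu> (f \<circ> (\<lambda>x. g + x)) = \<mu> f"
    using assms unfolding amenable_def by (elim exE conjE)
  have "invariant_mean \<mu>"
    by unfold_locales (use \<mu> in \<open>auto simp: comp_def\<close>)
  then show ?thesis
    by (rule that)
qed

theorem theorem6p1:
  fixes p :: real
  assumes "amenable TYPE('g::{topological_group_add, t2_space})"
    and "1 \<le> p"
  shows "\<exists>(V :: ('g, 'e::banach) point normed_space) (\<pi> :: 'g \<Rightarrow> ('g, 'e) point \<Rightarrow> ('g, 'e) point).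
    banach_space V \<and>
    finitely_representable V (Lp p :: (real \<Rightarrow> 'e) set normed_space) \<and>
    isometric_representation V \<pi> \<and>
    (\<forall>(d :: 'g \<Rightarrow> 'g \<Rightarrow> real) (\<sigma> :: 'g \<Rightarrow> 'e).
       continuous_pseudo_metric d \<and> left_invariant d \<and>
       unif_continuous d dist \<sigma> \<and> bornologous d dist \<sigma> \<longrightarrow>
       (\<exists>b. is_cocycle V \<pi> b \<and>
         (\<forall>x y.
            exact_compression_modulus d dist \<sigma> (ennreal (d x y)) \<le> ennreal (vnorm V (b x \<ominus>\<^bsub>V\<^esub> b y)) \<and>
            ennreal (vnorm V (b x \<ominus>\<^bsub>V\<^esub> b y)) \<le> expansion_modulus d dist \<sigma> (ennreal (d x y)))))"
proof -
  obtain \<mu> :: "('g \<Rightarrow> real) \<Rightarrow> real" where "invariant_mean \<mu>"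
    using assms(1) by (rule amenable_invariant_mean)
  then interpret invariant_mean \<mu> .
  interpret V: seminormed "vector_RUC :: ('g \<Rightarrow> 'e) set" "Lp_mean \<mu> p"
    by (rule seminormed_Lp_mean[OF assms(2)])
  interpret W: seminormed V.C V.L
    by (rule V.seminormed_completion)
  have "banach_space W.Q"
    by (rule W.banach_space_quotient) (rule V.completion_complete)
  moreover have "finitely_representable W.Q (Lp p :: (real \<Rightarrow> 'e) set normed_space)"
    by (rule finitely_representable_completion[OF assms(2)])
  moreover have "isometric_representation W.Q (\<lambda>g A. translate g ` A)"
    by (rule isometric_representation_translate(3)[OF assms(2)])
  moreover note translation_cocycle[OF assms(2), where 'e = 'e]
  ultimately show ?thesis
    by (intro exI[of _ W.Q] exI[of _ "\<lambda>g A. translate g ` A"]) blast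
qed

end
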